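(* Let $G$ be a graph and $t$ be a positive integer. Then $\operatorname{th}_{\gamma_P}(G)\le t$ if and only if there exist integers $a\ge 0$, $b\ge 0$, and $s\ge 1$ such that $s+b=t$ and $G$ can be obtained (up to isomorphism) from $\mathcal{G}(s,a,b)$ by 1. contracting path edges, 2. deleting complete edges, and/or 3. deleting cross edges so that the remaining cross edges saturate the $a$-vertices. Moreover, for a fixed $t$, it can be verified in time polynomial in the order of $G$ whether $G$ satisfies these conditions.
   Context: All graphs are finite, simple, undirected, and have at least one vertex. For $S\subseteq V(G)$, $N[S]$ is the set of vertices in $S$ or adjacent to a vertex of $S$. Given $G=(V,E)$ and $S\subseteq V$, initially (timestep $0$) the vertices of $S$ are colored; in timestep $1$ every vertex in $N[S]$ becomes colored; in each subsequent timestep, every vertex which is the only non-colored neighbor of some colored vertex becomes colored. $S$ is a power dominating set if all vertices eventually become colored, and then $\operatorname{ppt}(G;S)$ is the number of timesteps needed to color all of $G$ (so $\operatorname{ppt}(G;V)=0$). The power domination throttling number is $\operatorname{th}_{\gamma_P}(G)=\min\{|S|+\operatorname{ppt}(G;S): S \text{ a power dominating set of } G\}$. For integers $a\ge 0$, $b\ge 0$, $s\ge 1$, $\mathcal{G}(s,a,b)$ is the graph obtained from the disjoint union $K_s\,\dot\cup\,(K_a\square P_b)$ (where $\square$ is the Cartesian product, $K_m$ the complete graph and $P_m$ the path on $m$ vertices) by adding every possible edge between the disjoint copy of $K_s$ and a copy of $K_a$ in $K_a\square P_b$ whose vertices have minimum degree (i.e., the copy of $K_a$ at one end of the path $P_b$).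 If $a=0$ or $b=0$, then $\mathcal{G}(s,a,b)\simeq K_s$. A path edge of $\mathcal{G}(s,a,b)$ is an edge that belongs to one of the copies of $P_b$; a complete edge is an edge that belongs to one of the copies of $K_a$, or to $K_s$; a cross edge is an edge between $K_s$ and $K_a\square P_b$. The $s$-vertices and the $a$-vertices are the vertices in $K_s$ and $K_a$, respectively, that are incident to cross edges. A set of edges saturates a set of vertices if every vertex of the set is incident to some edge in the set of edges. Contracting an edge means removing it and identifying its endpoints into a single vertex (graphs remain simple). *)

theory Defs
  imports "HOL-Computational_Algebra.Polynomial"
begin

section \<open>Graphs\<close>

record 'a graph =
  verts :: "'a set"
  edges :: "'a set set"

definition simple_graph :: "'a graph \<Rightarrow> bool" where
  "simple_graph G \<longleftrightarrow> finite (verts G) \<and> verts G \<noteq> {} \<and>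
     (\<forall>e\<in>edges G. \<exists>u\<in>verts G. \<exists>v\<in>verts G. u \<noteq> v \<and> e = {u, v})"

definition adjacent :: "'a graph \<Rightarrow> 'a \<Rightarrow> 'a \<Rightarrow> bool" where
  "adjacent G u v \<longleftrightarrow> {u, v} \<in> edges G"

definition isomorphic :: "'a graph \<Rightarrow> 'b graph \<Rightarrow> bool" where
  "isomorphic G H \<longleftrightarrow> (\<exists>f. bij_betw f (verts G) (verts H) \<and>
     (\<forall>u\<in>verts G. \<forall>v\<in>verts G. adjacent G u v \<longleftrightarrow> adjacent H (f u) (f v)))"

definition complete_graph :: "nat \<Rightarrow> nat graph" where
  "complete_graph m = \<lparr>verts = {..<m}, edges = {{i, j} | i j. i < m \<and> j < m \<and> i \<noteq> j}\<rparr>"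

definition path_graph :: "nat \<Rightarrow> nat graph" where
  "path_graph m = \<lparr>verts = {..<m}, edges = {{i, Suc i} | i. Suc i < m}\<rparr>"

definition cartesian_product :: "'a graph \<Rightarrow> 'b graph \<Rightarrow> ('a \<times> 'b) graph" where
  "cartesian_product G H = \<lparr>verts = verts G \<times> verts H,
     edges = {{(x, y), (x', y)} | x x' y. {x, x'} \<in> edges G \<and> y \<in> verts H} \<union>
             {{(x, y), (x, y')} | x y y'. x \<in> verts G \<and> {y, y'} \<in> edges H}\<rparr>"

definition disjoint_union :: "'a graph \<Rightarrow> 'b graph \<Rightarrow> ('a + 'b) graph" where
  "disjoint_union G H = \<lparr>verts = verts G <+> verts H,
     edges = (`) Inl ` edges G \<union> (`) Inr ` edges H\<rparr>"

definition add_edges :: "'a graph \<Rightarrow> 'a set set \<Rightarrow> 'a graph" where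
  "add_edges G D = G\<lparr>edges := edges G \<union> D\<rparr>"

definition delete_edges :: "'a graph \<Rightarrow> 'a set set \<Rightarrow> 'a graph" where
  "delete_edges G D = G\<lparr>edges := edges G - D\<rparr>"

text \<open>Contracting all edges of \<open>F\<close> identifies two vertices iff they are joined by a path of
  edges of \<open>F\<close>. The merged vertices are represented by the classes of this relation; loops are
  dropped and parallel edges coincide, so the graph stays simple.\<close>

definition contract_edges :: "'a graph \<Rightarrow> 'a set set \<Rightarrow> 'a set graph" where
  "contract_edges G F = (let cls = (\<lambda>u. {(x, y). {x, y} \<in> F}\<^sup>* `` {u}) in
     \<lparr>verts = cls ` verts G,
      edges = {{cls u, cls v} | u v. {u, v} \<in> edges G \<and> cls u \<noteq> cls v}\<rparr>)"

definition saturates :: "'a set set \<Rightarrow> 'a set \<Rightarrow> bool" where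
  "saturates F W \<longleftrightarrow> (\<forall>v\<in>W. \<exists>e\<in>F. v \<in> e)"


section \<open>Power domination throttling\<close>

definition closed_nbhd :: "'a graph \<Rightarrow> 'a set \<Rightarrow> 'a set" where
  "closed_nbhd G S = S \<union> {v \<in> verts G. \<exists>u\<in>S. adjacent G u v}"

definition force_step :: "'a graph \<Rightarrow> 'a set \<Rightarrow> 'a set" where
  "force_step G C = C \<union> {v \<in> verts G. \<exists>u\<in>C. {w \<in> verts G. adjacent G u w \<and> w \<notin> C} = {v}}"

fun colored :: "'a graph \<Rightarrow> 'a set \<Rightarrow> nat \<Rightarrow> 'a set" where
  "colored G S 0 = S"
| "colored G S (Suc 0) = closed_nbhd G S"
| "colored G S (Suc (Suc k)) = force_step G (colored G S (Suc k))"

definition power_dominating :: "'a graph \<Rightarrow> 'a set \<Rightarrow> bool" where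
  "power_dominating G S \<longleftrightarrow> S \<subseteq> verts G \<and> (\<exists>k. colored G S k = verts G)"

definition ppt :: "'a graph \<Rightarrow> 'a set \<Rightarrow> nat" where
  "ppt G S = (LEAST k. colored G S k = verts G)"

definition power_throttling :: "'a graph \<Rightarrow> nat" where
  "power_throttling G = Min {card S + ppt G S | S. power_dominating G S}"


section \<open>The graphs \<open>\<G>(s, a, b)\<close>\<close>

text \<open>\<open>Inl k\<close> are the vertices of $K_s$; \<open>Inr (i, j)\<close> is the vertex on the \<open>i\<close>-th copy of $P_b$
  and in the \<open>j\<close>-th copy of $K_a$. The copy of $K_a$ joined to $K_s$ is the one with \<open>j = 0\<close>.\<close>

type_synonym gvertex = "nat + nat \<times> nat"

definition path_edges :: "nat \<Rightarrow> nat \<Rightarrow> nat \<Rightarrow> gvertex set set" where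
  "path_edges s a b = {{Inr (i, j), Inr (i, j')} | i j j'.
     i \<in> verts (complete_graph a) \<and> {j, j'} \<in> edges (path_graph b)}"

definition complete_edges :: "nat \<Rightarrow> nat \<Rightarrow> nat \<Rightarrow> gvertex set set" where
  "complete_edges s a b =
     {{Inl k, Inl k'} | k k'. {k, k'} \<in> edges (complete_graph s)} \<union>
     {{Inr (i, j), Inr (i', j)} | i i' j.
        {i, i'} \<in> edges (complete_graph a) \<and> j \<in> verts (path_graph b)}"

definition cross_edges :: "nat \<Rightarrow> nat \<Rightarrow> nat \<Rightarrow> gvertex set set" where
  "cross_edges s a b = {{Inl k, Inr (i, 0)} | k i. k < s \<and> i < a \<and> 0 < b}"

definition throttling_graph :: "nat \<Rightarrow> nat \<Rightarrow> nat \<Rightarrow> gvertex graph" where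
  "throttling_graph s a b =
     add_edges
       (disjoint_union (complete_graph s) (cartesian_product (complete_graph a) (path_graph b)))
       (cross_edges s a b)"

definition a_vertices :: "nat \<Rightarrow> nat \<Rightarrow> nat \<Rightarrow> gvertex set" where
  "a_vertices s a b =
     {v \<in> verts (throttling_graph s a b). v \<in> range Inr \<and> (\<exists>e\<in>cross_edges s a b. v \<in> e)}"

lemma image_doubletons: "(`) f ` {{g x, h x} | x. Q x} = {{f (g x), f (h x)} | x. Q x}"
proof -
  have "{{g x, h x} | x. Q x} = (\<lambda>x. {g x, h x}) ` Collect Q"
    and "{{f (g x), f (h x)} | x. Q x} = (\<lambda>x. {f (g x), f (h x)}) ` Collect Q"
    by blast+
  then show ?thesis by (simp add: image_image)
qed

lemma edges_throttling_graph:
  "edges (throttling_graph s a b) = path_edges s a b \<union> complete_edges s a b \<union> cross_edges s a b"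
proof -
  have 1: "(`) Inl ` edges (complete_graph s) =
      {{Inl k, Inl k'} :: gvertex set | k k'. {k, k'} \<in> edges (complete_graph s)}"
  proof -
    have A: "(`) Inl ` {{k, k'} | k k'. R k k'} =
        {{Inl k, Inl k'} :: gvertex set | k k'. R k k'}" for R
      using image_doubletons[where f = Inl and g = "\<lambda>(k, k'). k" and h = "\<lambda>(k, k'). k'"
          and Q = "\<lambda>(k, k'). R k k'"]
      by (simp only: split_paired_Ex prod.case)
    have "edges (complete_graph s) = {{k, k'} | k k'. {k, k'} \<in> edges (complete_graph s)}"
      unfolding complete_graph_def by fastforce
    then show ?thesis
      using A[of "\<lambda>k k'. {k, k'} \<in> edges (complete_graph s)"] by metis
  qed
  have 2: "(`) Inr ` edges (cartesian_product (complete_graph a) (path_graph b)) =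
      {{Inr (i, j), Inr (i', j)} :: gvertex set | i i' j.
         {i, i'} \<in> edges (complete_graph a) \<and> j \<in> verts (path_graph b)} \<union> path_edges s a b"
  proof -
    have A: "(`) Inr ` {{(i, j), (i', j)} | i i' j. R i i' j} =
        {{Inr (i, j), Inr (i', j)} :: gvertex set | i i' j. R i i' j}" for R
      using image_doubletons[where f = Inr and g = "\<lambda>(i, i', j). (i, j)" and h = "\<lambda>(i, i', j). (i', j)"
          and Q = "\<lambda>(i, i', j). R i i' j"]
      by (simp only: split_paired_Ex prod.case)
    have B: "(`) Inr ` {{(i, j), (i, j')} | i j j'. R i j j'} =
        {{Inr (i, j), Inr (i, j')} :: gvertex set | i j j'. R i j j'}" for R
      using image_doubletons[where f = Inr and g = "\<lambda>(i, j, j'). (i, j)" and h = "\<lambda>(i, j, j'). (i, j')"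
          and Q = "\<lambda>(i, j, j'). R i j j'"]
      by (simp only: split_paired_Ex prod.case)
    show ?thesis
      unfolding cartesian_product_def path_edges_def graph.simps image_Un A B ..
  qed
  have "edges (throttling_graph s a b) = (`) Inl ` edges (complete_graph s) \<union>
      (`) Inr ` edges (cartesian_product (complete_graph a) (path_graph b)) \<union> cross_edges s a b"
    by (simp add: throttling_graph_def add_edges_def disjoint_union_def)
  then show ?thesis
    unfolding 1 2 complete_edges_def by (simp only: Un_ac)
qed

text \<open>Contracting path edges never merges edges of different kinds, never turns a complete or
  cross edge into a loop, and identifies no two cross edges. Hence the order of the operations is
  immaterial: deleting an edge after contraction amounts to deleting all edges merged into it
  beforehand, and saturation of the \<open>a\<close>-vertices is unaffected.\<close>

definition obtainable :: "nat \<Rightarrow> nat \<Rightarrow> nat \<Rightarrow> 'a graph \<Rightarrow> bool" where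
  "obtainable s a b G \<longleftrightarrow> (\<exists>F D X.
     F \<subseteq> path_edges s a b \<and>
     D \<subseteq> complete_edges s a b \<and>
     X \<subseteq> cross_edges s a b \<and> saturates (cross_edges s a b - X) (a_vertices s a b) \<and>
     isomorphic G (contract_edges (delete_edges (throttling_graph s a b) (D \<union> X)) F))"


section \<open>Polynomial-time decidability\<close>

text \<open>Running time is measured on structured programs for a random access machine with unit
  cost. A state consists of registers and an indirectly addressed memory, both holding natural
  numbers. The only arithmetic operations are addition and truncated subtraction, so a number
  computed in \<open>k\<close> steps has \<open>O(k)\<close> bits beyond those of the input, and polynomial time on this
  machine is polynomial time on a Turing machine.\<close>

type_synonym state = "(nat \<Rightarrow> nat) \<times> (nat \<Rightarrow> nat)"

datatype expr = Const nat | Reg nat | Mem expr | Add expr expr | Sub expr expr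

fun eval :: "expr \<Rightarrow> state \<Rightarrow> nat" where
  "eval (Const n) \<sigma> = n"
| "eval (Reg r) \<sigma> = fst \<sigma> r"
| "eval (Mem e) \<sigma> = snd \<sigma> (eval e \<sigma>)"
| "eval (Add e1 e2) \<sigma> = eval e1 \<sigma> + eval e2 \<sigma>"
| "eval (Sub e1 e2) \<sigma> = eval e1 \<sigma> - eval e2 \<sigma>"

fun cost :: "expr \<Rightarrow> nat" where
  "cost (Const n) = 1"
| "cost (Reg r) = 1"
| "cost (Mem e) = Suc (cost e)"
| "cost (Add e1 e2) = Suc (cost e1 + cost e2)"
| "cost (Sub e1 e2) = Suc (cost e1 + cost e2)"

datatype prog =
    Skip
  | Assign nat expr
  | Store expr expr
  | Seq prog prog
  | Cond expr prog prog
  | While expr prog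

text \<open>\<open>runs c \<sigma> k \<tau>\<close>: started in \<open>\<sigma>\<close>, the program \<open>c\<close> halts in \<open>\<tau>\<close> after exactly \<open>k\<close> steps.
  A test succeeds iff its value is nonzero.\<close>

inductive runs :: "prog \<Rightarrow> state \<Rightarrow> nat \<Rightarrow> state \<Rightarrow> bool" where
  runs_Skip: "runs Skip \<sigma> 1 \<sigma>"
| runs_Assign: "runs (Assign r e) \<sigma> (Suc (cost e)) ((fst \<sigma>)(r := eval e \<sigma>), snd \<sigma>)"
| runs_Store: "runs (Store d e) \<sigma> (Suc (cost d + cost e))
     (fst \<sigma>, (snd \<sigma>)(eval d \<sigma> := eval e \<sigma>))"
| runs_Seq: "runs c1 \<sigma> k1 \<sigma>' \<Longrightarrow> runs c2 \<sigma>' k2 \<tau> \<Longrightarrow> runs (Seq c1 c2) \<sigma> (k1 + k2) \<tau>"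
| runs_Cond_True: "eval e \<sigma> \<noteq> 0 \<Longrightarrow> runs c1 \<sigma> k \<tau> \<Longrightarrow>
     runs (Cond e c1 c2) \<sigma> (Suc (cost e + k)) \<tau>"
| runs_Cond_False: "eval e \<sigma> = 0 \<Longrightarrow> runs c2 \<sigma> k \<tau> \<Longrightarrow>
     runs (Cond e c1 c2) \<sigma> (Suc (cost e + k)) \<tau>"
| runs_While_False: "eval e \<sigma> = 0 \<Longrightarrow> runs (While e c) \<sigma> (Suc (cost e)) \<sigma>"
| runs_While_True: "eval e \<sigma> \<noteq> 0 \<Longrightarrow> runs c \<sigma> k1 \<sigma>' \<Longrightarrow> runs (While e c) \<sigma>' k2 \<tau> \<Longrightarrow>
     runs (While e c) \<sigma> (Suc (cost e + k1 + k2)) \<tau>"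

text \<open>The input of a graph with its vertices listed as \<open>vs\<close>: memory cell 0 holds the order \<open>n\<close>,
  cells \<open>1, \<dots>, n\<^sup>2\<close> hold the adjacency matrix row by row, and everything else is 0.\<close>

definition adj_input :: "'a graph \<Rightarrow> 'a list \<Rightarrow> state" where
  "adj_input G vs = (let n = length vs in
     (\<lambda>_. 0,
      \<lambda>m. if m = 0 then n
          else if m \<le> n * n
          then of_bool (adjacent G (vs ! ((m - 1) div n)) (vs ! ((m - 1) mod n)))
          else 0))"

text \<open>The answer is returned in register 0.\<close>

definition polytime_decidable :: "('a graph \<Rightarrow> bool) \<Rightarrow> bool" where
  "polytime_decidable P \<longleftrightarrow> (\<exists>c (p :: nat poly). \<forall>G vs.
     simple_graph G \<and> distinct vs \<and> set vs = verts G \<longrightarrow>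
     (\<exists>k \<tau>. runs c (adj_input G vs) k \<tau> \<and> k \<le> poly p (card (verts G)) \<and>
            fst \<tau> 0 = of_bool (P G)))"

end

theory Submission
  imports Defs
begin

text \<open>After the first step the vertices of a power dominating set \<open>S\<close> have no uncolored neighbours,
  so all forcing happens along disjoint chains that start in \<open>N[S] - S\<close>. Let the cell \<open>(i, j)\<close> of
  the grid be the last vertex of the \<open>i\<close>-th chain colored by time \<open>j + 1\<close>: contracting the path
  edges between equal cells and deleting the complete and cross edges between nonadjacent vertices
  yields \<open>G\<close>. Conversely, in a graph obtained from \<open>\<G>(s, a, b)\<close> the \<open>j\<close>-th column is colored by
  time \<open>j + 1\<close>, because a cell of an earlier column has at most one neighbour beyond these columns, the
  next cell of its row.

  For fixed \<open>t\<close>, having throttling number at most \<open>t\<close> is a first-order property of the graph, and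
  first-order properties are decided by nested loops over the vertices.\<close>

section \<open>Coloring and throttling\<close>

text \<open>The obstacle is that chains advance at different times, whereas a complete edge joins
  cells of one column only. Columns therefore record time, not position on a chain: a chain that
  pauses repeats its current vertex, and each repetition is a path edge to contract. Column 0 stands
  for time 1, because domination colors all of N[S] at once; hence \<open>b\<close> columns reach
  exactly time \<open>b\<close>. There is one row for each vertex of N[S] outside \<open>S\<close>.
  Searching for \<open>F\<close>, \<open>D\<close> and \<open>X\<close> directly would range over
  exponentially many edge sets. The decision procedure tests the throttling bound instead, and the
  equivalence carries the result over. For fixed \<open>t\<close>, the choice of at most
  \<open>t\<close> vertices and the at most \<open>t\<close> rounds unfold into a number of
  quantifiers that depends on \<open>t\<close> only; each quantifier is one loop and raises the
  degree of the time bound by one.\<close>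

lemma colored_subset_verts: "S \<subseteq> verts G \<Longrightarrow> colored G S k \<subseteq> verts G"
  by (induction G S k rule: colored.induct) (auto simp: closed_nbhd_def force_step_def)

lemma colored_Suc_mono: "colored G S k \<subseteq> colored G S (Suc k)"
  by (cases k) (auto simp: closed_nbhd_def force_step_def)

lemma colored_mono: "k \<le> l \<Longrightarrow> colored G S k \<subseteq> colored G S l"
  by (rule lift_Suc_mono_le[of "colored G S"]) (rule colored_Suc_mono)

text \<open>Coloring is monotone in time, so finishing within \<open>t - card S\<close> steps is the
  same as being finished at that time, and the least such time disappears. The whole vertex set is
  power dominating, so the minimum ranges over a nonempty set.\<close>

lemma power_throttling_le_iff:
  assumes "simple_graph G"
  shows "power_throttling G \<le> t \<longleftrightarrow>
    (\<exists>S\<subseteq>verts G. card S \<le> t \<and> colored G S (t - card S) = verts G)"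
proof -
  let ?A = "{card S + ppt G S | S. power_dominating G S}"
  have "finite (Pow (verts G))" using assms by (simp add: simple_graph_def)
  moreover have "?A \<subseteq> (\<lambda>S. card S + ppt G S) ` Pow (verts G)" by (auto simp: power_dominating_def)
  ultimately have fin: "finite ?A" by (rule finite_surj)
  have "power_dominating G (verts G)"
    unfolding power_dominating_def by (intro conjI exI[of _ 0]) auto
  then have "?A \<noteq> {}" by blast
  with fin have "power_throttling G \<le> t \<longleftrightarrow> (\<exists>S. power_dominating G S \<and> card S + ppt G S \<le> t)"
    unfolding power_throttling_def by (subst Min_le_iff) auto
  also have "\<dots> \<longleftrightarrow> (\<exists>S\<subseteq>verts G. card S \<le> t \<and> colored G S (t - card S) = verts G)"
  proof (intro iffI)
    assume "\<exists>S. power_dominating G S \<and> card S + ppt G S \<le> t"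
    then obtain S where S: "power_dominating G S" "card S + ppt G S \<le> t" by blast
    then have sub: "S \<subseteq> verts G" and "colored G S (ppt G S) = verts G"
      using LeastI_ex[of "\<lambda>k. colored G S k = verts G"]
      unfolding power_dominating_def ppt_def by blast+
    then have "colored G S (t - card S) = verts G"
      using S(2) colored_mono[of "ppt G S" "t - card S" G S] colored_subset_verts[OF sub, of "t - card S"]
      by auto
    then show "\<exists>S\<subseteq>verts G. card S \<le> t \<and> colored G S (t - card S) = verts G"
      using S(2) sub by auto
  next
    assume "\<exists>S\<subseteq>verts G. card S \<le> t \<and> colored G S (t - card S) = verts G"
    then obtain S where S: "S \<subseteq> verts G" "card S \<le> t" "colored G S (t - card S) = verts G" by blast
    then have "ppt G S \<le> t - card S" unfolding ppt_def by (simp add: Least_le)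
    with S show "\<exists>S. power_dominating G S \<and> card S + ppt G S \<le> t"
      unfolding power_dominating_def by (intro exI[of _ S]) auto
  qed
  finally show ?thesis .
qed

lemma simple_graph_adjacentD:
  assumes "simple_graph G" "adjacent G u v"
  shows "u \<in> verts G" "v \<in> verts G" "u \<noteq> v"
  using assms unfolding simple_graph_def adjacent_def by (fastforce simp: doubleton_eq_iff)+

lemma adjacent_sym: "adjacent G u v \<longleftrightarrow> adjacent G v u"
  by (simp add: adjacent_def insert_commute)


section \<open>First-order properties are decidable in polynomial time\<close>

text \<open>The machine cannot multiply, so along with the index of the vertex \<open>\<rho> i\<close> in register \<open>2 * i + 1\<close>
  the offset of its row in the adjacency matrix is kept in register \<open>2 * i + 2\<close>.\<close>

definition encodes :: "nat \<Rightarrow> 'a list \<Rightarrow> (nat \<Rightarrow> 'a) \<Rightarrow> (nat \<Rightarrow> nat) \<Rightarrow> bool" where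
  "encodes d vs \<rho> R \<longleftrightarrow> (\<forall>i<d. R (2 * i + 1) < length vs \<and>
     R (2 * i + 2) = length vs * R (2 * i + 1) \<and> \<rho> i = vs ! R (2 * i + 1))"

text \<open>The contract that makes programs composable: the memory, the only copy of the input, is
  returned intact, the registers of the \<open>d\<close> variables in scope survive, register 0
  carries the truth value, and all higher registers are scratch space for inner quantifiers.\<close>

definition computes ::
    "nat \<Rightarrow> prog \<Rightarrow> nat poly \<Rightarrow> ('a graph \<Rightarrow> (nat \<Rightarrow> 'a) \<Rightarrow> bool) \<Rightarrow> bool" where
  "computes d c p Q \<longleftrightarrow> (\<forall>G vs \<rho> R.
     simple_graph G \<longrightarrow> distinct vs \<longrightarrow> set vs = verts G \<longrightarrow> encodes d vs \<rho> R \<longrightarrow>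
     (\<exists>k R'. runs c (R, snd (adj_input G vs)) k (R', snd (adj_input G vs)) \<and>
        k \<le> poly p (length vs) \<and> (\<forall>r. 0 < r \<and> r \<le> 2 * d \<longrightarrow> R' r = R r) \<and>
        R' 0 = of_bool (Q G \<rho>)))"

text \<open>A shallow embedding: instead of a syntax of formulas there are semantic predicates on
  valuations, with one closure lemma per connective and quantifier. Variables are numbered by
  quantifier depth, and those below \<open>d\<close> are free.\<close>

definition fo_decidable :: "nat \<Rightarrow> ('a graph \<Rightarrow> (nat \<Rightarrow> 'a) \<Rightarrow> bool) \<Rightarrow> bool" where
  "fo_decidable d Q \<longleftrightarrow> (\<exists>c p. computes d c p Q)"

lemma computesD:
  assumes "computes d c p Q" "simple_graph G" "distinct vs" "set vs = verts G" "encodes d vs \<rho> R"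
  obtains k R' where "runs c (R, snd (adj_input G vs)) k (R', snd (adj_input G vs))"
    "k \<le> poly p (length vs)" "\<And>r. 0 < r \<Longrightarrow> r \<le> 2 * d \<Longrightarrow> R' r = R r" "R' 0 = of_bool (Q G \<rho>)"
  using assms unfolding computes_def by metis

lemma encodes_cong:
  assumes "encodes d vs \<rho> R" and "\<And>r. 0 < r \<Longrightarrow> r \<le> 2 * d \<Longrightarrow> R' r = R r"
  shows "encodes d vs \<rho> R'"
  using assms unfolding encodes_def by (auto simp: less_imp_le)

lemma adj_input_order [simp]: "snd (adj_input G vs) 0 = length vs"
  by (simp add: adj_input_def Let_def)

text \<open>The \<open>Suc\<close> skips cell 0, which holds the order. The product is exactly the
  row offset kept in a register.\<close>

lemma adj_input_adjacent:
  assumes "i < length vs" "j < length vs"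
  shows "snd (adj_input G vs) (Suc (length vs * i + j)) = of_bool (adjacent G (vs ! i) (vs ! j))"
proof -
  let ?n = "length vs"
  have "?n * i + j < ?n * Suc i" using assms(2) by simp
  also have "\<dots> \<le> ?n * ?n" using assms(1) by (intro mult_le_mono) auto
  finally have "?n * i + j < ?n * ?n" .
  moreover have "(?n * i + j) div ?n = i" "(?n * i + j) mod ?n = j"
    using assms(2) by (auto simp: div_nat_eqI algebra_simps)
  ultimately show ?thesis using assms by (simp add: adj_input_def Let_def)
qed

section \<open>Atomic formulas, connectives and quantifiers\<close>

lemma fo_decidable_expr:
  assumes "\<And>G vs \<rho> R. simple_graph G \<Longrightarrow> distinct vs \<Longrightarrow> set vs = verts G \<Longrightarrow> encodes d vs \<rho> R \<Longrightarrow>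
    eval e (R, snd (adj_input G vs)) = of_bool (Q G \<rho>)"
  shows "fo_decidable d Q"
proof -
  have "computes d (Assign 0 e) [:Suc (cost e):] Q"
    unfolding computes_def
  proof (intro allI impI)
    fix G :: "'a graph" and vs :: "'a list" and \<rho> :: "nat \<Rightarrow> 'a" and R :: "nat \<Rightarrow> nat"
    assume *: "simple_graph G" "distinct vs" "set vs = verts G" "encodes d vs \<rho> R"
    let ?M = "snd (adj_input G vs)"
    have "runs (Assign 0 e) (R, ?M) (Suc (cost e)) (R(0 := eval e (R, ?M)), ?M)"
      using runs_Assign[of 0 e "(R, ?M)"] by simp
    then show "\<exists>k R'. runs (Assign 0 e) (R, ?M) k (R', ?M) \<and> k \<le> poly [:Suc (cost e):] (length vs) \<and>
        (\<forall>r. 0 < r \<and> r \<le> 2 * d \<longrightarrow> R' r = R r) \<and> R' 0 = of_bool (Q G \<rho>)"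
      using assms[OF *] by (intro exI[of _ "Suc (cost e)"] exI[of _ "R(0 := eval e (R, ?M))"]) auto
  qed
  then show ?thesis unfolding fo_decidable_def by blast
qed

lemma fo_decidable_const: "fo_decidable d (\<lambda>G \<rho>. P)"
  by (rule fo_decidable_expr[where e = "Const (of_bool P)"]) simp

lemma fo_decidable_adjacent:
  assumes "x < d" "y < d"
  shows "fo_decidable d (\<lambda>G \<rho>. adjacent G (\<rho> x) (\<rho> y))"
proof (rule fo_decidable_expr)
  fix G :: "'a graph" and vs :: "'a list" and \<rho> :: "nat \<Rightarrow> 'a" and R :: "nat \<Rightarrow> nat"
  assume "encodes d vs \<rho> R"
  then show "eval (Mem (Add (Const 1) (Add (Reg (2 * x + 2)) (Reg (2 * y + 1)))))
      (R, snd (adj_input G vs)) = of_bool (adjacent G (\<rho> x) (\<rho> y))"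
    using assms by (simp add: encodes_def adj_input_adjacent)
qed

lemma fo_decidable_eq:
  assumes "x < d" "y < d"
  shows "fo_decidable d (\<lambda>G \<rho>. \<rho> x = \<rho> y)"
proof (rule fo_decidable_expr)
  fix G :: "'a graph" and vs :: "'a list" and \<rho> :: "nat \<Rightarrow> 'a" and R :: "nat \<Rightarrow> nat"
  assume "encodes d vs \<rho> R" "distinct vs"
  then have "\<rho> x = \<rho> y \<longleftrightarrow> R (2 * x + 1) = R (2 * y + 1)"
    using assms by (simp add: encodes_def nth_eq_iff_index_eq)
  \<comment> \<open>With truncated subtraction the two differences sum to the distance of the
    indices, so the value is 1 if the indices agree and 0 otherwise.\<close>
  then show "eval (Sub (Const 1) (Add (Sub (Reg (2 * x + 1)) (Reg (2 * y + 1)))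
        (Sub (Reg (2 * y + 1)) (Reg (2 * x + 1))))) (R, snd (adj_input G vs)) = of_bool (\<rho> x = \<rho> y)"
    by auto
qed

lemma fo_decidable_not:
  assumes "fo_decidable d Q"
  shows "fo_decidable d (\<lambda>G \<rho>. \<not> Q G \<rho>)"
proof -
  from assms obtain c p where c: "computes d c p Q" unfolding fo_decidable_def by blast
  let ?e = "Sub (Const 1) (Reg 0)"
  let ?c = "Seq c (Assign 0 ?e)" and ?p = "p + [:4:]"
  have "computes d ?c ?p (\<lambda>G \<rho>. \<not> Q G \<rho>)"
    unfolding computes_def
  proof (intro allI impI)
    fix G :: "'a graph" and vs :: "'a list" and \<rho> :: "nat \<Rightarrow> 'a" and R :: "nat \<Rightarrow> nat"
    assume *: "simple_graph G" "distinct vs" "set vs = verts G" "encodes d vs \<rho> R"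
    let ?M = "snd (adj_input G vs)"
    from computesD[OF c *] obtain k R' where R': "runs c (R, ?M) k (R', ?M)"
      "k \<le> poly p (length vs)" "\<And>r. 0 < r \<Longrightarrow> r \<le> 2 * d \<Longrightarrow> R' r = R r" "R' 0 = of_bool (Q G \<rho>)"
      by blast
    have "runs ?c (R, ?M) (k + 4) (R'(0 := 1 - R' 0), ?M)"
      using runs_Seq[OF R'(1) runs_Assign[of 0 ?e]] by (simp add: numeral_eq_Suc)
    then show "\<exists>k R'. runs ?c (R, ?M) k (R', ?M) \<and> k \<le> poly ?p (length vs) \<and>
        (\<forall>r. 0 < r \<and> r \<le> 2 * d \<longrightarrow> R' r = R r) \<and> R' 0 = of_bool (\<not> Q G \<rho>)"
      using R' by (intro exI[of _ "k + 4"] exI[of _ "R'(0 := 1 - R' 0)"]) auto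
  qed
  then show ?thesis unfolding fo_decidable_def by blast
qed

lemma fo_decidable_conj:
  assumes "fo_decidable d Q1" "fo_decidable d Q2"
  shows "fo_decidable d (\<lambda>G \<rho>. Q1 G \<rho> \<and> Q2 G \<rho>)"
proof -
  from assms obtain c1 p1 c2 p2 where c: "computes d c1 p1 Q1" "computes d c2 p2 Q2"
    unfolding fo_decidable_def by blast
  \<comment> \<open>If \<open>c1\<close> answers 0, register 0 already holds the value of the
    conjunction, and skipping costs the 3 extra steps.\<close>
  let ?c = "Seq c1 (Cond (Reg 0) c2 Skip)" and ?p = "p1 + p2 + [:3:]"
  have "computes d ?c ?p (\<lambda>G \<rho>. Q1 G \<rho> \<and> Q2 G \<rho>)"
    unfolding computes_def
  proof (intro allI impI)
    fix G :: "'a graph" and vs :: "'a list" and \<rho> :: "nat \<Rightarrow> 'a" and R :: "nat \<Rightarrow> nat"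
    assume *: "simple_graph G" "distinct vs" "set vs = verts G" "encodes d vs \<rho> R"
    let ?M = "snd (adj_input G vs)"
    from computesD[OF c(1) *] obtain k1 R1 where R1: "runs c1 (R, ?M) k1 (R1, ?M)"
      "k1 \<le> poly p1 (length vs)" "\<And>r. 0 < r \<Longrightarrow> r \<le> 2 * d \<Longrightarrow> R1 r = R r" "R1 0 = of_bool (Q1 G \<rho>)"
      by blast
    have "encodes d vs \<rho> R1" using encodes_cong[OF *(4)] R1(3) by blast
    from computesD[OF c(2) *(1-3) this] obtain k2 R2 where R2: "runs c2 (R1, ?M) k2 (R2, ?M)"
      "k2 \<le> poly p2 (length vs)" "\<And>r. 0 < r \<Longrightarrow> r \<le> 2 * d \<Longrightarrow> R2 r = R1 r" "R2 0 = of_bool (Q2 G \<rho>)"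
      by blast
    show "\<exists>k R'. runs ?c (R, ?M) k (R', ?M) \<and> k \<le> poly ?p (length vs) \<and>
        (\<forall>r. 0 < r \<and> r \<le> 2 * d \<longrightarrow> R' r = R r) \<and> R' 0 = of_bool (Q1 G \<rho> \<and> Q2 G \<rho>)"
    proof (cases "Q1 G \<rho>")
      case True
      then have "runs ?c (R, ?M) (k1 + (Suc (Suc k2))) (R2, ?M)"
        using runs_Seq[OF R1(1) runs_Cond_True[OF _ R2(1), where e = "Reg 0"]] R1(4) by simp
      then show ?thesis using R1 R2 True by (intro exI[of _ "k1 + Suc (Suc k2)"] exI[of _ R2]) auto
    next
      case False
      then have "runs ?c (R, ?M) (k1 + 3) (R1, ?M)"
        using runs_Seq[OF R1(1) runs_Cond_False[OF _ runs_Skip, where e = "Reg 0"]] R1(4)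
        by (simp add: numeral_eq_Suc)
      then show ?thesis using R1 False by (intro exI[of _ "k1 + 3"] exI[of _ R1]) auto
    qed
  qed
  then show ?thesis unfolding fo_decidable_def by blast
qed

lemma fo_decidable_disj:
  assumes "fo_decidable d Q1" "fo_decidable d Q2"
  shows "fo_decidable d (\<lambda>G \<rho>. Q1 G \<rho> \<or> Q2 G \<rho>)"
  using fo_decidable_not[OF fo_decidable_conj[OF assms[THEN fo_decidable_not]]] by simp

text \<open>A loop over all indices of \<open>vs\<close>, with the bound variable stored in the
  first two registers above those in scope. Each round costs one run of \<open>c\<close> plus a
  constant, so the time bound is multiplied by the order. The constants 10 and 30 are
  generous.\<close>

lemma fo_decidable_ex:
  assumes "fo_decidable (Suc d) Q"
  shows "fo_decidable d (\<lambda>G \<rho>. \<exists>v\<in>verts G. Q G (\<rho>(d := v)))"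
proof -
  from assms obtain c p where c: "computes (Suc d) c p Q" unfolding fo_decidable_def by blast
  define x y where "x = 2 * d + 1" and "y = 2 * d + 2"
  let ?n = "Mem (Const 0)"
  let ?next = "Seq (Assign x (Add (Reg x) (Const 1))) (Assign y (Add (Reg y) ?n))"
  \<comment> \<open>Once a witness is found, \<open>x\<close> jumps to the order, so the loop test
    fails and register 0 keeps the value 1.\<close>
  let ?body = "Seq c (Cond (Reg 0) (Assign x ?n) ?next)"
  let ?loop = "While (Sub ?n (Reg x)) ?body"
  let ?c = "Seq (Assign 0 (Const 0)) (Seq (Assign x (Const 0)) (Seq (Assign y (Const 0)) ?loop))"
  let ?p = "[:0, 1:] * (p + [:30:]) + [:30:]"
  have "computes d ?c ?p (\<lambda>G \<rho>. \<exists>v\<in>verts G. Q G (\<rho>(d := v)))"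
    unfolding computes_def
  proof (intro allI impI)
    fix G :: "'a graph" and vs :: "'a list" and \<rho> :: "nat \<Rightarrow> 'a" and R :: "nat \<Rightarrow> nat"
    assume *: "simple_graph G" "distinct vs" "set vs = verts G" "encodes d vs \<rho> R"
    let ?M = "snd (adj_input G vs)" and ?B = "poly p (length vs)"
    \<comment> \<open>Invariant: register 0 is 0 because no index below \<open>m\<close> is a
      witness, and \<open>j\<close> indices remain. The answer concerns the indices from
      \<open>m\<close> on only.\<close>
    have loop: "\<exists>k R'. runs ?loop (R, ?M) k (R', ?M) \<and> k \<le> j * (?B + 30) + 10 \<and>
        (\<forall>r. 0 < r \<and> r \<le> 2 * d \<longrightarrow> R' r = R r) \<and>
        R' 0 = of_bool (\<exists>i<length vs. m \<le> i \<and> Q G (\<rho>(d := vs ! i)))"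
      if "encodes d vs \<rho> R" "R 0 = 0" "R x = m" "R y = length vs * m" "m + j = length vs" for m j R
      using that
    proof (induction j arbitrary: m R)
      case 0
      then have "runs ?loop (R, ?M) 5 (R, ?M)"
        using runs_While_False[of "Sub ?n (Reg x)" "(R, ?M)"] by (simp add: numeral_eq_Suc)
      then show ?case using 0 by (intro exI[of _ 5] exI[of _ R]) auto
    next
      case (Suc j)
      have test: "eval (Sub ?n (Reg x)) (R, ?M) \<noteq> 0" using Suc.prems by simp
      \<comment> \<open>The values of \<open>x\<close> and \<open>y\<close> are precisely the
        encoding of \<open>vs ! m\<close> as variable number \<open>d\<close>.\<close>
      have "encodes (Suc d) vs (\<rho>(d := vs ! m)) R"
        using Suc.prems unfolding encodes_def x_def y_def by (auto simp: less_Suc_eq)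
      from computesD[OF c *(1-3) this] obtain k R' where R': "runs c (R, ?M) k (R', ?M)" "k \<le> ?B"
        "\<And>r. 0 < r \<Longrightarrow> r \<le> 2 * Suc d \<Longrightarrow> R' r = R r" "R' 0 = of_bool (Q G (\<rho>(d := vs ! m)))"
        by blast
      have xy: "R' x = m" "R' y = length vs * m" using R'(3) Suc.prems by (auto simp: x_def y_def)
      show ?case
      proof (cases "Q G (\<rho>(d := vs ! m))")
        case True
        let ?R = "R'(x := length vs)"
        have "runs ?body (R, ?M) (k + 5) (?R, ?M)"
          using runs_Seq[OF R'(1) runs_Cond_True[OF _ runs_Assign[of x ?n], where e = "Reg 0"]] R'(4) True
          by (simp add: numeral_eq_Suc)
        moreover have "runs ?loop (?R, ?M) 5 (?R, ?M)"
          using runs_While_False[of "Sub ?n (Reg x)" "(?R, ?M)"] by (simp add: numeral_eq_Suc)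
        ultimately have "runs ?loop (R, ?M) (Suc (cost (Sub ?n (Reg x)) + (k + 5) + 5)) (?R, ?M)"
          by (rule runs_While_True[OF test])
        moreover have "?R 0 = of_bool (\<exists>i<length vs. m \<le> i \<and> Q G (\<rho>(d := vs ! i)))"
          using R'(4) True Suc.prems by (auto simp: x_def)
        moreover have "Suc (cost (Sub ?n (Reg x)) + (k + 5) + 5) \<le> Suc j * (?B + 30) + 10"
          using R'(2) by simp
        moreover have "\<forall>r. 0 < r \<and> r \<le> 2 * d \<longrightarrow> ?R r = R r"
          using R'(3) by (simp add: x_def)
        ultimately show ?thesis by blast
      next
        case False
        let ?R = "R'(x := Suc m, y := length vs * Suc m)"
        have "runs ?next (R', ?M) (4 + 5) (?R, ?M)"
          using runs_Seq[OF runs_Assign[of x "Add (Reg x) (Const 1)" "(R', ?M)"]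
              runs_Assign[of y "Add (Reg y) ?n"]] xy
          by (simp add: numeral_eq_Suc x_def y_def add.commute)
        then have "runs ?body (R, ?M) (k + 11) (?R, ?M)"
          using runs_Seq[OF R'(1) runs_Cond_False[where e = "Reg 0"]] R'(4) False by fastforce
        moreover have "encodes d vs \<rho> ?R"
          by (rule encodes_cong[OF Suc.prems(1)]) (use R'(3) in \<open>auto simp: x_def y_def\<close>)
        moreover have "?R 0 = 0" "?R x = Suc m" "?R y = length vs * Suc m" "Suc m + j = length vs"
          using R'(4) False Suc.prems by (auto simp: x_def y_def)
        ultimately obtain k' R'' where R'': "runs ?loop (?R, ?M) k' (R'', ?M)"
          "k' \<le> j * (?B + 30) + 10" "\<forall>r. 0 < r \<and> r \<le> 2 * d \<longrightarrow> R'' r = ?R r"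
          "R'' 0 = of_bool (\<exists>i<length vs. Suc m \<le> i \<and> Q G (\<rho>(d := vs ! i)))"
          and body: "runs ?body (R, ?M) (k + 11) (?R, ?M)"
          using Suc.IH by blast
        have "runs ?loop (R, ?M) (Suc (cost (Sub ?n (Reg x)) + (k + 11) + k')) (R'', ?M)"
          by (rule runs_While_True[OF test body R''(1)])
        moreover have "(\<exists>i<length vs. m \<le> i \<and> Q G (\<rho>(d := vs ! i))) \<longleftrightarrow>
            (\<exists>i<length vs. Suc m \<le> i \<and> Q G (\<rho>(d := vs ! i)))"
          using False by (metis Suc_leD not_less_eq_eq le_antisym)
        then have "R'' 0 = of_bool (\<exists>i<length vs. m \<le> i \<and> Q G (\<rho>(d := vs ! i)))"
          by (simp only: R''(4))
        moreover have "Suc (cost (Sub ?n (Reg x)) + (k + 11) + k') \<le> Suc j * (?B + 30) + 10"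
          using R'(2) R''(2) by simp
        moreover have "\<forall>r. 0 < r \<and> r \<le> 2 * d \<longrightarrow> R'' r = R r"
          using R'(3) R''(3) by (simp add: x_def y_def)
        ultimately show ?thesis by blast
      qed
    qed
    let ?R = "R(0 := 0, x := 0, y := 0)"
    have "encodes d vs \<rho> ?R" by (rule encodes_cong[OF *(4)]) (auto simp: x_def y_def)
    moreover have "?R 0 = 0" "?R x = 0" "?R y = length vs * 0" "0 + length vs = length vs"
      by (auto simp: x_def y_def)
    ultimately obtain k R' where R': "runs ?loop (?R, ?M) k (R', ?M)"
      "k \<le> length vs * (?B + 30) + 10" "\<forall>r. 0 < r \<and> r \<le> 2 * d \<longrightarrow> R' r = ?R r"
      "R' 0 = of_bool (\<exists>i<length vs. 0 \<le> i \<and> Q G (\<rho>(d := vs ! i)))"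
      using loop by blast
    have "runs ?c (R, ?M) (2 + (2 + (2 + k))) (R', ?M)"
      using runs_Seq[OF runs_Assign[of 0 "Const 0" "(R, ?M)"]
          runs_Seq[OF runs_Assign[of x "Const 0"] runs_Seq[OF runs_Assign[of y "Const 0"]]]] R'(1)
      by (simp add: numeral_eq_Suc)
    moreover have "2 + (2 + (2 + k)) \<le> poly ?p (length vs)"
      using R'(2) by simp
    moreover have "\<forall>r. 0 < r \<and> r \<le> 2 * d \<longrightarrow> R' r = R r"
      using R'(3) by (simp add: x_def y_def)
    moreover have "(\<exists>v\<in>verts G. Q G (\<rho>(d := v))) \<longleftrightarrow>
        (\<exists>i<length vs. 0 \<le> i \<and> Q G (\<rho>(d := vs ! i)))"
      using *(3) by (metis in_set_conv_nth le0)
    then have "R' 0 = of_bool (\<exists>v\<in>verts G. Q G (\<rho>(d := v)))"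
      by (simp only: R'(4))
    ultimately show "\<exists>k R'. runs ?c (R, ?M) k (R', ?M) \<and> k \<le> poly ?p (length vs) \<and>
        (\<forall>r. 0 < r \<and> r \<le> 2 * d \<longrightarrow> R' r = R r) \<and> R' 0 = of_bool (\<exists>v\<in>verts G. Q G (\<rho>(d := v)))"
      by blast
  qed
  then show ?thesis unfolding fo_decidable_def by blast
qed

lemma fo_decidable_all:
  assumes "fo_decidable (Suc d) Q"
  shows "fo_decidable d (\<lambda>G \<rho>. \<forall>v\<in>verts G. Q G (\<rho>(d := v)))"
  using fo_decidable_not[OF fo_decidable_ex[OF assms[THEN fo_decidable_not]]] by simp

lemma polytime_decidable_if_fo_decidable:
  assumes "fo_decidable 0 (\<lambda>G _. P G)"
  shows "polytime_decidable P"
proof -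
  from assms obtain c p where c: "computes 0 c p (\<lambda>G (_ :: nat \<Rightarrow> 'a). P G)"
    unfolding fo_decidable_def by blast
  show ?thesis
    unfolding polytime_decidable_def
  proof (intro exI[of _ c] exI[of _ p] allI impI)
    fix G :: "'a graph" and vs
    assume *: "simple_graph G \<and> distinct vs \<and> set vs = verts G"
    have "adj_input G vs = (\<lambda>_. 0, snd (adj_input G vs))" by (simp add: adj_input_def Let_def)
    moreover have "encodes 0 vs undefined (\<lambda>_. 0)" by (simp add: encodes_def)
    moreover have "card (verts G) = length vs" using * distinct_card by metis
    ultimately show "\<exists>k \<tau>. runs c (adj_input G vs) k \<tau> \<and> k \<le> poly p (card (verts G)) \<and>
        fst \<tau> 0 = of_bool (P G)"
      using computesD[OF c, of G vs] * by (metis fst_conv)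
  qed
qed

text \<open>Encoded valuations take their values in the list of vertices, so predicates need to
  agree only on valuations inside the graph.\<close>

lemma fo_decidable_cong:
  assumes "\<And>G \<rho>. simple_graph G \<Longrightarrow> (\<And>i. i < d \<Longrightarrow> \<rho> i \<in> verts G) \<Longrightarrow> Q G \<rho> \<longleftrightarrow> Q' G \<rho>"
  shows "fo_decidable d Q \<longleftrightarrow> fo_decidable d Q'"
proof -
  have "Q G \<rho> \<longleftrightarrow> Q' G \<rho>" if "simple_graph G" "set vs = verts G" "encodes d vs \<rho> R" for G vs \<rho> R
  proof (rule assms)
    fix i assume "i < d"
    then show "\<rho> i \<in> verts G" using that by (metis encodes_def nth_mem)
  qed (rule that(1))
  then have "computes d c p Q \<longleftrightarrow> computes d c p Q'" for c p
    unfolding computes_def by (intro iff_allI imp_cong refl) simp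
  then show ?thesis unfolding fo_decidable_def by simp
qed

text \<open>The bound is a constant of the program, so this is a finite disjunction unrolled into
  the code and not a loop.\<close>

lemma fo_decidable_ex_less:
  fixes s :: nat
  assumes "\<And>i. i < s \<Longrightarrow> fo_decidable d (Q i)"
  shows "fo_decidable d (\<lambda>G \<rho>. \<exists>i<s. Q i G \<rho>)"
  using assms
proof (induction s)
  case 0
  then show ?case using fo_decidable_const[of d False] by simp
next
  case (Suc s)
  then show ?case
    using fo_decidable_disj[of d "Q s" "\<lambda>G \<rho>. \<exists>i<s. Q i G \<rho>"] by (simp add: Ex_less_Suc)
qed

section \<open>Coloring and throttling as first-order properties\<close>

lemma force_step_iff:
  assumes "v \<in> verts G" "C \<subseteq> verts G"
  shows "v \<in> force_step G C \<longleftrightarrow> v \<in> C \<or> (\<exists>u\<in>verts G. u \<in> C \<and> adjacent G u v \<and> v \<notin> C \<and>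
    (\<forall>w\<in>verts G. w \<in> C \<or> \<not> adjacent G u w \<or> w = v))"
  using assms unfolding force_step_def by blast

text \<open>The set \<open>S\<close> is given by the first \<open>s\<close> variables. A forcing
  round introduces two fresh variables, the forcing vertex \<open>d\<close> and a competing
  neighbour \<open>Suc d\<close>; so \<open>x\<close> and \<open>d\<close> must vary in the
  induction on the time.\<close>

lemma fo_decidable_colored:
  assumes "x < d" "s \<le> d"
  shows "fo_decidable d (\<lambda>G \<rho>. \<rho> x \<in> colored G (\<rho> ` {..<s}) k)"
  using assms
proof (induction k arbitrary: x d rule: induct_nat_012)
  case 0
  have "fo_decidable d (\<lambda>G \<rho>. \<exists>i<s. \<rho> x = \<rho> i)"
    using 0 by (intro fo_decidable_ex_less fo_decidable_eq) auto
  moreover have "(\<rho> x \<in> colored G (\<rho> ` {..<s}) 0) = (\<exists>i<s. \<rho> x = \<rho> i)" for G and \<rho> :: "nat \<Rightarrow> 'a"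
    by auto
  ultimately show ?case by simp
next
  case 1
  have "fo_decidable d (\<lambda>G \<rho>. \<exists>i<s. \<rho> x = \<rho> i \<or> adjacent G (\<rho> i) (\<rho> x))"
    using 1 by (intro fo_decidable_ex_less fo_decidable_disj fo_decidable_eq fo_decidable_adjacent) auto
  then show ?case
    by (rule fo_decidable_cong[THEN iffD1, rotated]) (use 1 in \<open>auto simp: closed_nbhd_def\<close>)
next
  case (ge2 k)
  let ?C = "\<lambda>(G :: 'a graph) \<rho>. colored G (\<rho> ` {..<s}) (Suc k)"
  let ?W = "\<lambda>G \<rho>. \<rho> (Suc d) \<in> ?C G \<rho> \<or> \<not> adjacent G (\<rho> d) (\<rho> (Suc d)) \<or> \<rho> (Suc d) = \<rho> x"
  let ?U = "\<lambda>G \<rho>. \<rho> d \<in> ?C G \<rho> \<and> adjacent G (\<rho> d) (\<rho> x) \<and> \<not> \<rho> x \<in> ?C G \<rho> \<and>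
    (\<forall>w\<in>verts G. ?W G (\<rho>(Suc d := w)))"
  let ?Q = "\<lambda>G \<rho>. \<rho> x \<in> ?C G \<rho> \<or> (\<exists>u\<in>verts G. ?U G (\<rho>(d := u)))"
  have "fo_decidable d ?Q"
    using ge2.prems
    by (intro fo_decidable_disj fo_decidable_ex fo_decidable_conj fo_decidable_not fo_decidable_all
        fo_decidable_adjacent fo_decidable_eq ge2.IH(2)) auto
  then show ?case
  proof (rule fo_decidable_cong[THEN iffD1, rotated])
    fix G :: "'a graph" and \<rho>
    assume \<rho>: "\<And>i. i < d \<Longrightarrow> \<rho> i \<in> verts G"
    let ?S = "\<rho> ` {..<s}"
    \<comment> \<open>Since \<open>s \<le> d\<close>, the fresh variables lie beyond those that list
      \<open>S\<close>.\<close>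
    have img: "(\<rho>(d := u)) ` {..<s} = ?S" "(\<rho>(d := u, Suc d := w)) ` {..<s} = ?S" for u w
      using ge2.prems by (auto simp: image_def)
    have "colored G ?S (Suc k) \<subseteq> verts G"
      using \<rho> ge2.prems by (intro colored_subset_verts) auto
    then have "\<rho> x \<in> force_step G (colored G ?S (Suc k)) \<longleftrightarrow> \<rho> x \<in> colored G ?S (Suc k) \<or>
      (\<exists>u\<in>verts G. u \<in> colored G ?S (Suc k) \<and> adjacent G u (\<rho> x) \<and> \<rho> x \<notin> colored G ?S (Suc k) \<and>
        (\<forall>w\<in>verts G. w \<in> colored G ?S (Suc k) \<or> \<not> adjacent G u w \<or> w = \<rho> x))"
      using ge2.prems \<rho> by (intro force_step_iff) auto
    then show "?Q G \<rho> \<longleftrightarrow> \<rho> x \<in> colored G ?S (Suc (Suc k))"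
      using ge2.prems by (simp add: img)
  qed
qed

text \<open>Each list entry becomes one quantifier. The image of the variables in scope accumulates
  the entries chosen so far, hence the induction with \<open>d\<close> arbitrary.\<close>

lemma fo_decidable_ex_list:
  assumes "fo_decidable (d + m) (\<lambda>G \<rho>. P G (\<rho> ` {..<d + m}))"
  shows "fo_decidable d (\<lambda>G \<rho>. \<exists>xs. length xs = m \<and> set xs \<subseteq> verts G \<and> P G (\<rho> ` {..<d} \<union> set xs))"
  using assms
proof (induction m arbitrary: d)
  case 0
  then show ?case by simp
next
  case (Suc m)
  let ?R = "\<lambda>G A. \<exists>xs. length xs = m \<and> set xs \<subseteq> verts G \<and> P G (A \<union> set xs)"
  have "fo_decidable d (\<lambda>G \<rho>. \<exists>v\<in>verts G. ?R G ((\<rho>(d := v)) ` {..<Suc d}))"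
    using Suc.prems by (intro fo_decidable_ex Suc.IH) simp
  moreover have "(\<exists>v\<in>verts G. ?R G ((\<rho>(d := v)) ` {..<Suc d})) \<longleftrightarrow>
      (\<exists>xs. length xs = Suc m \<and> set xs \<subseteq> verts G \<and> P G (\<rho> ` {..<d} \<union> set xs))" for G \<rho>
  proof -
    have "(\<rho>(d := v)) ` {..<Suc d} = insert v (\<rho> ` {..<d})" for v
      by (auto simp: lessThan_Suc)
    moreover have "(\<exists>xs. length xs = Suc m \<and> set xs \<subseteq> verts G \<and> P G (\<rho> ` {..<d} \<union> set xs)) \<longleftrightarrow>
        (\<exists>v xs. length xs = m \<and> insert v (set xs) \<subseteq> verts G \<and> P G (\<rho> ` {..<d} \<union> insert v (set xs)))"
      unfolding length_Suc_conv by (metis list.simps(15))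
    ultimately show ?thesis by auto
  qed
  ultimately show ?case by simp
qed

lemma fo_decidable_colored_list:
  "fo_decidable 0 (\<lambda>(G :: 'a graph) _. \<exists>xs. length xs = s \<and> set xs \<subseteq> verts G \<and> colored G (set xs) k = verts G)"
proof -
  have "fo_decidable s (\<lambda>(G :: 'a graph) \<rho>. \<forall>v\<in>verts G. (\<rho>(s := v)) s \<in> colored G ((\<rho>(s := v)) ` {..<s}) k)"
    by (intro fo_decidable_all fo_decidable_colored) auto
  moreover have "(\<forall>v\<in>verts G. (\<rho>(s := v)) s \<in> colored G ((\<rho>(s := v)) ` {..<s}) k) \<longleftrightarrow>
      verts G \<subseteq> colored G (\<rho> ` {..<s}) k" for G :: "'a graph" and \<rho>
  proof -
    have "(\<rho>(s := v)) ` {..<s} = \<rho> ` {..<s}" for v by (auto simp: image_def)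
    then show ?thesis by auto
  qed
  ultimately have "fo_decidable (0 + s) (\<lambda>(G :: 'a graph) \<rho>. verts G \<subseteq> colored G (\<rho> ` {..<0 + s}) k)"
    by (simp only: add_0)
  from fo_decidable_ex_list[OF this]
  have "fo_decidable 0 (\<lambda>G (_ :: nat \<Rightarrow> 'a). \<exists>xs. length xs = s \<and> set xs \<subseteq> verts G \<and>
      verts G \<subseteq> colored G (set xs) k)" by simp
  moreover have "(set xs \<subseteq> verts G \<and> verts G \<subseteq> colored G (set xs) k) \<longleftrightarrow>
      (set xs \<subseteq> verts G \<and> colored G (set xs) k = verts G)" for G :: "'a graph" and xs
    using colored_subset_verts by blast
  ultimately show ?thesis by simp
qed

text \<open>Lists may repeat entries, so one of length \<open>s\<close> can give a smaller set. That
  set then has more than \<open>t - s\<close> steps available, and extra time does no harm by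
  monotonicity.\<close>

lemma power_throttling_le_iff_list:
  assumes "simple_graph G"
  shows "power_throttling G \<le> t \<longleftrightarrow>
    (\<exists>s<Suc t. \<exists>xs. length xs = s \<and> set xs \<subseteq> verts G \<and> colored G (set xs) (t - s) = verts G)"
  unfolding power_throttling_le_iff[OF assms]
proof (intro iffI; elim exE conjE)
  fix S assume S: "S \<subseteq> verts G" "card S \<le> t" "colored G S (t - card S) = verts G"
  then have "finite S" using assms finite_subset by (auto simp: simple_graph_def)
  then obtain xs where "set xs = S" "length xs = card S"
    using finite_distinct_list distinct_card by metis
  with S show "\<exists>s<Suc t. \<exists>xs. length xs = s \<and> set xs \<subseteq> verts G \<and> colored G (set xs) (t - s) = verts G"
    by (intro exI[of _ "card S"]) auto
next
  fix s xs assume s: "s < Suc t" "length xs = s" "set xs \<subseteq> verts G" "colored G (set xs) (t - s) = verts G"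
  have le: "card (set xs) \<le> s" using card_length[of xs] s by simp
  then have "colored G (set xs) (t - card (set xs)) = verts G"
    using colored_mono[of "t - s" "t - card (set xs)" G "set xs"] s
      colored_subset_verts[OF s(3), of "t - card (set xs)"] by auto
  with s le show "\<exists>S\<subseteq>verts G. card S \<le> t \<and> colored G S (t - card S) = verts G"
    by (intro exI[of _ "set xs"]) auto
qed

lemma polytime_decidable_cong:
  assumes "\<And>G. simple_graph G \<Longrightarrow> P G \<longleftrightarrow> Q G"
  shows "polytime_decidable P \<longleftrightarrow> polytime_decidable Q"
  unfolding polytime_decidable_def
  by (intro ex_cong1 iff_allI imp_cong refl) (simp add: assms)

lemma polytime_decidable_power_throttling_le:
  "polytime_decidable (\<lambda>G. power_throttling G \<le> t)"
proof -
  have "fo_decidable 0 (\<lambda>G (_ :: nat \<Rightarrow> 'a). \<exists>s<Suc t. \<exists>xs. length xs = s \<and> set xs \<subseteq> verts G \<and>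
      colored G (set xs) (t - s) = verts G)"
    by (intro fo_decidable_ex_less fo_decidable_colored_list)
  from polytime_decidable_if_fo_decidable[OF this] show ?thesis
    by (rule polytime_decidable_cong[THEN iffD1, rotated]) (simp add: power_throttling_le_iff_list)
qed


section \<open>Contraction maps\<close>

text \<open>The quotient map of a contraction, composed with an isomorphism: a surjection onto
  \<open>G\<close> whose fibres are the components of \<open>F\<close>. It allows reasoning with
  vertices of \<open>G\<close> instead of classes.\<close>

definition contraction_map ::
    "'b graph \<Rightarrow> 'b set set \<Rightarrow> 'a graph \<Rightarrow> ('b \<Rightarrow> 'a) \<Rightarrow> bool" where
  "contraction_map H F G \<phi> \<longleftrightarrow> \<phi> ` verts H = verts G \<and>
     (\<forall>x\<in>verts H. \<forall>y\<in>verts H. \<phi> x = \<phi> y \<longleftrightarrow> (x, y) \<in> {(x, y). {x, y} \<in> F}\<^sup>*) \<and>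
     (\<forall>u\<in>verts G. \<forall>v\<in>verts G. adjacent G u v \<longleftrightarrow>
        u \<noteq> v \<and> (\<exists>x y. {x, y} \<in> edges H \<and> \<phi> x = u \<and> \<phi> y = v))"

lemma isomorphic_contract_edges_iff:
  assumes H: "\<And>x y. {x, y} \<in> edges H \<Longrightarrow> x \<in> verts H \<and> y \<in> verts H"
  shows "isomorphic G (contract_edges H F) \<longleftrightarrow> (\<exists>\<phi>. contraction_map H F G \<phi>)"
proof -
  let ?R = "{(x, y). {x, y} \<in> F}\<^sup>*"
  define cls where "cls = (\<lambda>u. ?R `` {u})"
  have "sym {(x, y). {x, y} \<in> F}" by (auto simp: sym_def insert_commute)
  then have "sym ?R" by (rule sym_rtrancl)
  then have "equiv UNIV ?R"
    by (simp add: equiv_def refl_rtrancl trans_rtrancl)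
  then have cls_eq: "cls x = cls y \<longleftrightarrow> (x, y) \<in> ?R" for x y
    unfolding cls_def using eq_equiv_class_iff[of UNIV ?R x y] by simp
  have K: "verts (contract_edges H F) = cls ` verts H"
    "edges (contract_edges H F) = {{cls u, cls v} | u v. {u, v} \<in> edges H \<and> cls u \<noteq> cls v}"
    by (simp_all only: contract_edges_def cls_def Let_def graph.simps)
  have adj: "adjacent (contract_edges H F) X Y \<longleftrightarrow>
      X \<noteq> Y \<and> (\<exists>x y. {x, y} \<in> edges H \<and> cls x = X \<and> cls y = Y)" for X Y
  proof -
    have "adjacent (contract_edges H F) X Y \<longleftrightarrow>
        (\<exists>x y. {X, Y} = {cls x, cls y} \<and> {x, y} \<in> edges H \<and> cls x \<noteq> cls y)"
      by (simp only: adjacent_def K mem_Collect_eq)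
    then show ?thesis unfolding doubleton_eq_iff by (metis insert_commute)
  qed
  show ?thesis
  proof
    assume "isomorphic G (contract_edges H F)"
    then obtain f where f: "bij_betw f (verts G) (cls ` verts H)"
      "\<forall>u\<in>verts G. \<forall>v\<in>verts G. adjacent G u v \<longleftrightarrow> adjacent (contract_edges H F) (f u) (f v)"
      unfolding isomorphic_def K by blast
    \<comment> \<open>The class map followed by the inverse of the isomorphism.\<close>
    define \<phi> where "\<phi> x = the_inv_into (verts G) f (cls x)" for x
    have inj: "inj_on f (verts G)" and im: "f ` verts G = cls ` verts H"
      using f(1) by (auto simp: bij_betw_def)
    have f\<phi>: "f (\<phi> x) = cls x" if "x \<in> verts H" for x
      unfolding \<phi>_def using inj im that by (intro f_the_inv_into_f) auto
    have \<phi>V: "\<phi> x \<in> verts G" if "x \<in> verts H" for x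
      unfolding \<phi>_def using inj im that by (intro the_inv_into_into) auto
    have \<phi>_eq: "\<phi> x = u \<longleftrightarrow> cls x = f u" if "x \<in> verts H" "u \<in> verts G" for x u
      using f\<phi> \<phi>V that inj by (metis inj_onD)
    have "\<phi> ` verts H = verts G"
    proof
      show "verts G \<subseteq> \<phi> ` verts H"
      proof
        fix u assume u: "u \<in> verts G"
        then obtain x where "x \<in> verts H" "cls x = f u" using im by (metis imageE imageI)
        then show "u \<in> \<phi> ` verts H" using \<phi>_eq u by blast
      qed
    qed (use \<phi>V in blast)
    moreover have "\<forall>x\<in>verts H. \<forall>y\<in>verts H. \<phi> x = \<phi> y \<longleftrightarrow> (x, y) \<in> ?R"
      using \<phi>_eq \<phi>V f\<phi> cls_eq by metis
    moreover have "\<forall>u\<in>verts G. \<forall>v\<in>verts G. adjacent G u v \<longleftrightarrow>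
        u \<noteq> v \<and> (\<exists>x y. {x, y} \<in> edges H \<and> \<phi> x = u \<and> \<phi> y = v)"
    proof (intro ballI)
      fix u v assume uv: "u \<in> verts G" "v \<in> verts G"
      have "adjacent G u v \<longleftrightarrow> f u \<noteq> f v \<and> (\<exists>x y. {x, y} \<in> edges H \<and> cls x = f u \<and> cls y = f v)"
        using f(2) uv adj by simp
      also have "\<dots> \<longleftrightarrow> u \<noteq> v \<and> (\<exists>x y. {x, y} \<in> edges H \<and> \<phi> x = u \<and> \<phi> y = v)"
      proof -
        have "f u = f v \<longleftrightarrow> u = v" using inj uv by (simp add: inj_on_eq_iff)
        moreover have "{x, y} \<in> edges H \<and> cls x = f u \<and> cls y = f v \<longleftrightarrow>
            {x, y} \<in> edges H \<and> \<phi> x = u \<and> \<phi> y = v" for x y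
          using H[of x y] \<phi>_eq uv by blast
        ultimately show ?thesis by simp
      qed
      finally show "adjacent G u v \<longleftrightarrow>
        u \<noteq> v \<and> (\<exists>x y. {x, y} \<in> edges H \<and> \<phi> x = u \<and> \<phi> y = v)" .
    qed
    ultimately have "contraction_map H F G \<phi>" unfolding contraction_map_def by (intro conjI)
    then show "\<exists>\<phi>. contraction_map H F G \<phi>" by blast
  next
    assume "\<exists>\<phi>. contraction_map H F G \<phi>"
    then obtain \<phi> where map: "contraction_map H F G \<phi>" by blast
    have im: "\<phi> ` verts H = verts G"
      using map unfolding contraction_map_def by (elim conjE)
    have eq: "\<phi> x = \<phi> y \<longleftrightarrow> cls x = cls y" if "x \<in> verts H" "y \<in> verts H" for x y
      using map that unfolding contraction_map_def cls_eq by simp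
    \<comment> \<open>A representative of each fibre; its class is independent of the choice,
      because the fibres are exactly the classes.\<close>
    define g where "g = inv_into (verts H) \<phi>"
    have gH: "g u \<in> verts H" and \<phi>g: "\<phi> (g u) = u" if "u \<in> verts G" for u
      unfolding g_def using im that by (auto intro: inv_into_into f_inv_into_f)
    have cls_g: "cls x = cls (g u) \<longleftrightarrow> \<phi> x = u" if "x \<in> verts H" "u \<in> verts G" for x u
      using eq gH \<phi>g that by metis
    let ?f = "\<lambda>u. cls (g u)"
    have "inj_on ?f (verts G)"
      using cls_g gH \<phi>g by (intro inj_onI) metis
    moreover have "?f ` verts G = cls ` verts H"
    proof
      show "cls ` verts H \<subseteq> ?f ` verts G"
      proof
        fix X assume "X \<in> cls ` verts H"
        then obtain x where "x \<in> verts H" "X = cls x" by blast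
        moreover from this have "\<phi> x \<in> verts G" using im by blast
        ultimately show "X \<in> ?f ` verts G" using cls_g by blast
      qed
    qed (use gH in blast)
    moreover have "adjacent G u v \<longleftrightarrow> adjacent (contract_edges H F) (?f u) (?f v)"
      if uv: "u \<in> verts G" "v \<in> verts G" for u v
    proof -
      have "adjacent (contract_edges H F) (?f u) (?f v) \<longleftrightarrow>
        ?f u \<noteq> ?f v \<and> (\<exists>x y. {x, y} \<in> edges H \<and> cls x = ?f u \<and> cls y = ?f v)" by (rule adj)
      also have "\<dots> \<longleftrightarrow> u \<noteq> v \<and> (\<exists>x y. {x, y} \<in> edges H \<and> \<phi> x = u \<and> \<phi> y = v)"
      proof -
        have "?f u = ?f v \<longleftrightarrow> u = v" using cls_g[OF gH] \<phi>g uv by simp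
        moreover have "{x, y} \<in> edges H \<and> cls x = ?f u \<and> cls y = ?f v \<longleftrightarrow>
            {x, y} \<in> edges H \<and> \<phi> x = u \<and> \<phi> y = v" for x y
          using H[of x y] cls_g uv by blast
        ultimately show ?thesis by simp
      qed
      finally show ?thesis using map uv unfolding contraction_map_def by simp
    qed
    ultimately show "isomorphic G (contract_edges H F)"
      unfolding isomorphic_def bij_betw_def K by (intro exI[of _ ?f] conjI ballI)
  qed
qed

section \<open>Vertices and kinds of edges of \<open>throttling_graph\<close>\<close>

lemma verts_throttling_graph:
  "verts (throttling_graph s a b) = Inl ` {..<s} \<union> Inr ` ({..<a} \<times> {..<b})"
  by (auto simp: throttling_graph_def add_edges_def disjoint_union_def complete_graph_def
      path_graph_def cartesian_product_def)

lemma path_edges_iff: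
  "{x, y} \<in> path_edges s a b \<longleftrightarrow> (\<exists>i j. i < a \<and> Suc j < b \<and>
     ((x = Inr (i, j) \<and> y = Inr (i, Suc j)) \<or> (y = Inr (i, j) \<and> x = Inr (i, Suc j))))"
  (is "_ \<longleftrightarrow> ?P")
proof -
  have "{j, j'} \<in> edges (path_graph b) \<longleftrightarrow> (Suc j < b \<and> j' = Suc j) \<or> (Suc j' < b \<and> j = Suc j')" for j j'
    by (auto simp: path_graph_def doubleton_eq_iff)
  then show ?thesis
    unfolding path_edges_def complete_graph_def mem_Collect_eq doubleton_eq_iff by auto
qed

lemma edges_complete_graph_iff: "{i, j} \<in> edges (complete_graph m) \<longleftrightarrow> i < m \<and> j < m \<and> i \<noteq> j"
  by (auto simp: complete_graph_def doubleton_eq_iff)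

lemma complete_edges_iff:
  "{x, y} \<in> complete_edges s a b \<longleftrightarrow>
     (\<exists>k k'. k < s \<and> k' < s \<and> k \<noteq> k' \<and> x = Inl k \<and> y = Inl k') \<or>
     (\<exists>i i' j. i < a \<and> i' < a \<and> i \<noteq> i' \<and> j < b \<and> x = Inr (i, j) \<and> y = Inr (i', j))"
  unfolding complete_edges_def Un_iff mem_Collect_eq doubleton_eq_iff edges_complete_graph_iff
  by (auto simp: path_graph_def) blast+

lemma cross_edges_iff:
  "{x, y} \<in> cross_edges s a b \<longleftrightarrow> (\<exists>k i. k < s \<and> i < a \<and> 0 < b \<and>
     ((x = Inl k \<and> y = Inr (i, 0)) \<or> (y = Inl k \<and> x = Inr (i, 0))))"
  unfolding cross_edges_def mem_Collect_eq doubleton_eq_iff by blast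

lemma a_vertices_eq:
  assumes "s \<ge> 1"
  shows "a_vertices s a b = {Inr (i, 0) | i. i < a \<and> 0 < b}"
proof (intro set_eqI iffI)
  fix v :: gvertex assume "v \<in> a_vertices s a b"
  then obtain k i where "v \<in> {Inl k, Inr (i, 0)}" "v \<in> range Inr" "i < a" "0 < b"
    unfolding a_vertices_def cross_edges_def by auto
  then show "v \<in> {Inr (i, 0) | i. i < a \<and> 0 < b}" by auto
next
  fix v :: gvertex assume "v \<in> {Inr (i, 0) | i. i < a \<and> 0 < b}"
  then obtain i where i: "v = Inr (i, 0)" "i < a" "0 < b" by blast
  with assms have "{Inl 0, v} \<in> cross_edges s a b" by (auto simp: cross_edges_iff)
  with i show "v \<in> a_vertices s a b"
    unfolding a_vertices_def verts_throttling_graph by blast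
qed


section \<open>Forcing chains\<close>

text \<open>Several vertices may be able to force \<open>v\<close> in the same step. Fixing one of
  them for each \<open>v\<close> is what keeps the chains disjoint.\<close>

definition forcer :: "'a graph \<Rightarrow> 'a set \<Rightarrow> nat \<Rightarrow> 'a \<Rightarrow> 'a" where
  "forcer G S j v = (SOME u. u \<in> colored G S (Suc j) \<and>
     {w \<in> verts G. adjacent G u w \<and> w \<notin> colored G S (Suc j)} = {v})"

text \<open>The front stays in place while it is not the chosen forcer of any newly colored vertex;
  a chain whose vertices have all been colored repeats its last vertex forever.\<close>

fun front :: "'a graph \<Rightarrow> 'a set \<Rightarrow> 'a \<Rightarrow> nat \<Rightarrow> 'a" where
  "front G S u 0 = u"
| "front G S u (Suc j) =
     (if \<exists>v \<in> colored G S (Suc (Suc j)) - colored G S (Suc j). forcer G S j v = front G S u j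
      then SOME v. v \<in> colored G S (Suc (Suc j)) - colored G S (Suc j) \<and> forcer G S j v = front G S u j
      else front G S u j)"

lemma forcer:
  assumes "v \<in> colored G S (Suc (Suc j)) - colored G S (Suc j)"
  shows "forcer G S j v \<in> colored G S (Suc j)"
    and "{w \<in> verts G. adjacent G (forcer G S j v) w \<and> w \<notin> colored G S (Suc j)} = {v}"
proof -
  let ?P = "\<lambda>u. u \<in> colored G S (Suc j) \<and>
     {w \<in> verts G. adjacent G u w \<and> w \<notin> colored G S (Suc j)} = {v}"
  have "v \<in> force_step G (colored G S (Suc j)) - colored G S (Suc j)"
    using assms by simp
  then have "\<exists>u. ?P u" unfolding force_step_def by blast
  then have "?P (forcer G S j v)" unfolding forcer_def by (rule someI_ex)
  then show "forcer G S j v \<in> colored G S (Suc j)"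
    and "{w \<in> verts G. adjacent G (forcer G S j v) w \<and> w \<notin> colored G S (Suc j)} = {v}" by auto
qed

text \<open>The choice in \<open>front\<close> is no real choice: the forcing vertex has a single
  uncolored neighbour, so it is the forcer of at most one new vertex.\<close>

lemma front_Suc_moved:
  assumes "v \<in> colored G S (Suc (Suc j)) - colored G S (Suc j)" "forcer G S j v = front G S u j"
  shows "front G S u (Suc j) = v"
proof -
  let ?P = "\<lambda>v. v \<in> colored G S (Suc (Suc j)) - colored G S (Suc j) \<and> forcer G S j v = front G S u j"
  have ex: "\<exists>v \<in> colored G S (Suc (Suc j)) - colored G S (Suc j). forcer G S j v = front G S u j"
    using assms by blast
  then have "\<exists>v. ?P v" by blast
  then have "?P (SOME v. ?P v)" by (rule someI_ex)
  moreover have "front G S u (Suc j) = (SOME v. ?P v)"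
    unfolding front.simps if_P[OF ex] ..
  ultimately have P: "?P (front G S u (Suc j))" by (simp only:)
  then have "{front G S u (Suc j)} =
      {w \<in> verts G. adjacent G (front G S u j) w \<and> w \<notin> colored G S (Suc j)}"
    using forcer(2)[of "front G S u (Suc j)" G S j] by (simp only:)
  also have "\<dots> = {v}" using forcer(2)[OF assms(1)] assms(2) by (simp only:)
  finally show ?thesis by blast
qed

lemma front_Suc_cases:
  obtains (stay) "front G S u (Suc j) = front G S u j"
      "\<And>v. v \<in> colored G S (Suc (Suc j)) - colored G S (Suc j) \<Longrightarrow> forcer G S j v \<noteq> front G S u j"
  | (move) "front G S u (Suc j) \<in> colored G S (Suc (Suc j)) - colored G S (Suc j)"
      "forcer G S j (front G S u (Suc j)) = front G S u j"
      "front G S u j \<in> colored G S (Suc j)"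
      "{w \<in> verts G. adjacent G (front G S u j) w \<and> w \<notin> colored G S (Suc j)} =
         {front G S u (Suc j)}"
proof (cases "\<exists>v \<in> colored G S (Suc (Suc j)) - colored G S (Suc j). forcer G S j v = front G S u j")
  case True
  then obtain v where v: "v \<in> colored G S (Suc (Suc j)) - colored G S (Suc j)"
    "forcer G S j v = front G S u j" by blast
  from front_Suc_moved[OF this] have "front G S u (Suc j) = v" .
  with v forcer[OF v(1)] show ?thesis by (intro move) auto
next
  case False
  then show ?thesis by (intro stay) auto
qed

declare front.simps(2) [simp del] colored.simps(3) [simp del]

lemma front_colored:
  assumes "u \<in> closed_nbhd G S"
  shows "front G S u j \<in> colored G S (Suc j)"
proof (induction j)
  case 0
  then show ?case using assms by simp
next
  case (Suc j)
  then show ?case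
    using colored_Suc_mono[of G S "Suc j"] by (cases rule: front_Suc_cases[of G S u j]) (metis subsetD, blast)
qed

lemma front_notin:
  assumes "u \<notin> S"
  shows "front G S u j \<notin> S"
proof (induction j)
  case 0
  then show ?case using assms by simp
next
  case (Suc j)
  have "S \<subseteq> colored G S (Suc j)" using colored_mono[of 0 "Suc j" G S] by simp
  then show ?case
    using Suc by (cases rule: front_Suc_cases[of G S u j]) auto
qed

text \<open>Chains never merge. If both fronts move to the same vertex, they were both its chosen
  forcer; if only one moves, its new vertex was uncolored while the other front was already
  colored.\<close>

lemma front_inj:
  assumes "u \<in> closed_nbhd G S" "u' \<in> closed_nbhd G S" "front G S u j = front G S u' j"
  shows "u = u'"
  using assms(3)
proof (induction j)
  case 0
  then show ?case by simp
next
  case (Suc j)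
  have "front G S u j \<in> colored G S (Suc j)" "front G S u' j \<in> colored G S (Suc j)"
    using assms by (auto intro: front_colored)
  then have "front G S u j = front G S u' j"
    using Suc.prems
    by (cases rule: front_Suc_cases[of G S u j]; cases rule: front_Suc_cases[of G S u' j]) auto
  then show ?case by (rule Suc.IH)
qed

text \<open>A vertex of \<open>S\<close> has no uncolored neighbour after the first step, so only vertices on the
  forcing chains can ever force.\<close>

lemma front_covers_forcing:
  assumes "c \<in> colored G S (Suc j)" "adjacent G c w" "w \<in> verts G" "w \<notin> colored G S (Suc j)"
  shows "\<exists>u\<in>closed_nbhd G S - S. front G S u j = c"
  using assms
proof (induction j arbitrary: c w)
  case 0
  \<comment> \<open>All neighbours of \<open>S\<close> are colored at time 1, so \<open>c\<close> is
    itself a starting point of a chain.\<close>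
  then show ?case by (auto simp: closed_nbhd_def)
next
  case (Suc j)
  show ?case
  proof (cases "c \<in> colored G S (Suc j)")
    case False
    then have c: "c \<in> colored G S (Suc (Suc j)) - colored G S (Suc j)" using Suc.prems by blast
    from forcer(2)[OF c] have "adjacent G (forcer G S j c) c" "c \<in> verts G" by auto
    with Suc.IH[OF forcer(1)[OF c] _ _ False]
    obtain u where u: "u \<in> closed_nbhd G S - S" "front G S u j = forcer G S j c" by blast
    from front_Suc_moved[OF c u(2)[symmetric]] u(1) show ?thesis by blast
  next
    case True
    have w: "w \<notin> colored G S (Suc j)" using Suc.prems(4) colored_Suc_mono[of G S "Suc j"] by blast
    then obtain u where u: "u \<in> closed_nbhd G S - S" "front G S u j = c"
      using Suc.IH[OF True Suc.prems(2,3) w] by blast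
    show ?thesis
    proof (cases rule: front_Suc_cases[of G S u j])
      case stay
      with u show ?thesis by auto
    next
      case move
      \<comment> \<open>A front that moves has just colored its only uncolored neighbour, so
        \<open>w\<close> would be colored.\<close>
      have "w \<in> {front G S u (Suc j)}" unfolding move(4)[symmetric] u(2) using w Suc.prems(2,3) by blast
      with move(1) Suc.prems(4) show ?thesis by blast
    qed
  qed
qed

text \<open>The forcer of a newly colored vertex still had an uncolored neighbour, so it is the
  front of a chain, which then moves to the new vertex.\<close>

lemma front_covers:
  assumes "v \<in> colored G S (Suc j) - S"
  shows "\<exists>u\<in>closed_nbhd G S - S. \<exists>i\<le>j. front G S u i = v"
  using assms
proof (induction j)
  case 0
  then show ?case by (intro bexI[of _ v]) auto
next
  case (Suc j)
  show ?case
  proof (cases "v \<in> colored G S (Suc j)")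
    case True
    with Suc show ?thesis using le_Suc_eq by blast
  next
    case False
    then have v: "v \<in> colored G S (Suc (Suc j)) - colored G S (Suc j)" using Suc.prems by blast
    from forcer(2)[OF v] have "adjacent G (forcer G S j v) v" "v \<in> verts G" by auto
    with front_covers_forcing[OF forcer(1)[OF v] _ _ False]
    obtain u where u: "u \<in> closed_nbhd G S - S" "front G S u j = forcer G S j v" by blast
    from front_Suc_moved[OF v u(2)[symmetric]] u(1) show ?thesis by blast
  qed
qed

text \<open>A front moves only to vertices uncolored until then, so a front vertex already colored
  at time \<open>Suc j\<close> was reached by then and has not been left.\<close>

lemma front_stays:
  assumes "j \<le> l" "front G S u l \<in> colored G S (Suc j)"
  shows "front G S u j = front G S u l"
  using assms
proof (induction l rule: dec_induct)
  case base
  then show ?case by simp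
next
  case (step l)
  have "colored G S (Suc j) \<subseteq> colored G S (Suc l)" using step.hyps by (intro colored_mono) simp
  then have "front G S u (Suc l) = front G S u l"
    using step.prems by (cases rule: front_Suc_cases[of G S u l]) auto
  with step show ?case by simp
qed

text \<open>Each vertex off \<open>S\<close> thus occupies an interval of columns in a single row, a
  set that path edges can contract.\<close>

lemma front_eqD:
  assumes "u \<in> closed_nbhd G S" "u' \<in> closed_nbhd G S" "j \<le> j'" "front G S u j = front G S u' j'"
  shows "u = u'" and "\<And>l. j \<le> l \<Longrightarrow> l \<le> j' \<Longrightarrow> front G S u l = front G S u j"
proof -
  have col: "front G S u' j' \<in> colored G S (Suc j)" using front_colored[OF assms(1), of j] assms(4) by simp
  then have "front G S u' j = front G S u j" using front_stays[OF assms(3)] assms(4) by simp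
  then show "u = u'" using front_inj[OF assms(1,2), of j] by simp
  fix l assume l: "j \<le> l" "l \<le> j'"
  then have "colored G S (Suc j) \<subseteq> colored G S (Suc l)" by (intro colored_mono) simp
  then show "front G S u l = front G S u j"
    using front_stays[of l j' G S u'] col l assms \<open>u = u'\<close> by auto
qed

lemma front_adjacent_Suc:
  assumes "front G S u (Suc j) \<noteq> front G S u j"
  shows "adjacent G (front G S u j) (front G S u (Suc j))"
  using assms by (cases rule: front_Suc_cases[of G S u j]) auto

text \<open>If \<open>front u\<close> moved on before \<open>front u'\<close> reached its neighbour \<open>v\<close>, then \<open>v\<close> was a second
  uncolored neighbour at the time of the move. So adjacent vertices of different chains are
  active simultaneously.\<close>

lemma front_adjacentD:
  assumes "simple_graph G" "u \<in> closed_nbhd G S" "u' \<in> closed_nbhd G S" "j \<le> j'"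
    and "adjacent G (front G S u j) (front G S u' j')"
  shows "(\<exists>l. j \<le> l \<and> l \<le> j' \<and> front G S u l = front G S u j \<and> front G S u' l = front G S u' j') \<or>
    (u = u' \<and> (\<exists>l. j \<le> l \<and> l < j' \<and> front G S u l = front G S u j \<and> front G S u (Suc l) = front G S u j'))"
  using assms(4,5)
\<comment> \<open>The earlier index is advanced while its front stays. When that front moves, its
  neighbour is either already the front of the other chain at \<open>j\<close>, or the very vertex
  moved to.\<close>
proof (induction "j' - j" arbitrary: j)
  case 0
  then show ?case by (intro disjI1 exI[of _ j]) simp
next
  case (Suc n)
  let ?v = "front G S u' j'"
  have j: "Suc j \<le> j'" "n = j' - Suc j" using Suc.hyps(2) by auto
  show ?case
  proof (cases rule: front_Suc_cases[of G S u j])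
    case stay
    with Suc.hyps(1)[OF j(2) j(1)] Suc.prems(2) show ?thesis by (simp only:) (meson Suc_leD)
  next
    case move
    show ?thesis
    proof (cases "?v \<in> colored G S (Suc j)")
      case True
      from front_stays[OF Suc.prems(1) True] Suc.prems(1) show ?thesis
        by (intro disjI1 exI[of _ j]) simp
    next
      case False
      moreover have "?v \<in> verts G" using simple_graph_adjacentD[OF assms(1) Suc.prems(2)] by simp
      ultimately have v: "?v = front G S u (Suc j)" using move(4) Suc.prems(2) by blast
      then have "?v \<in> colored G S (Suc (Suc j))" using move(1) by simp
      then have "front G S u' (Suc j) = ?v" by (rule front_stays[OF j(1)])
      then have "u = u'" using v front_inj[OF assms(2,3), of "Suc j"] by simp
      moreover have "j < j'" using j by simp
      ultimately show ?thesis using v by (intro disjI2 conjI exI[of _ j]) auto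
    qed
  qed
qed


section \<open>Graphs obtained from \<open>\<G>(s, a, b)\<close>\<close>

lemma colored_empty: "colored G {} k = {}"
proof -
  have "colored G {} k = S \<Longrightarrow> S = {}" for S
    by (induction G "{} :: 'a set" k arbitrary: S rule: colored.induct)
      (auto simp: closed_nbhd_def force_step_def colored.simps)
  then show ?thesis by blast
qed

lemma path_edges_Suc:
  "i < a \<Longrightarrow> Suc j < b \<Longrightarrow> {Inr (i, j), Inr (i, Suc j)} \<in> path_edges s a b"
  unfolding path_edges_iff by blast

text \<open>Ensures that deleting edges of one kind leaves the other kinds alone; in particular all
  path edges survive \<open>D\<close> and \<open>X\<close>.\<close>

lemma edge_kinds_disjoint:
  "{x, y} \<in> path_edges s a b \<Longrightarrow> {x, y} \<notin> complete_edges s a b \<union> cross_edges s a b"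
  "{x, y} \<in> complete_edges s a b \<Longrightarrow> {x, y} \<notin> cross_edges s a b"
  unfolding Un_iff path_edges_iff complete_edges_iff cross_edges_iff by auto

lemma edges_throttling_graph_verts:
  assumes "{x, y} \<in> edges (throttling_graph s a b)"
  shows "x \<in> verts (throttling_graph s a b) \<and> y \<in> verts (throttling_graph s a b)"
  using assms
  unfolding edges_throttling_graph Un_iff path_edges_iff complete_edges_iff cross_edges_iff
    verts_throttling_graph by auto

lemma verts_delete_edges [simp]: "verts (delete_edges G D) = verts G"
  by (simp add: delete_edges_def)

lemma edges_delete_edges [simp]: "edges (delete_edges G D) = edges G - D"
  by (simp add: delete_edges_def)

lemma obtainable_iff:
  "obtainable s a b G \<longleftrightarrow> (\<exists>F D X \<phi>.
     F \<subseteq> path_edges s a b \<and> D \<subseteq> complete_edges s a b \<and> X \<subseteq> cross_edges s a b \<and>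
     saturates (cross_edges s a b - X) (a_vertices s a b) \<and>
     contraction_map (delete_edges (throttling_graph s a b) (D \<union> X)) F G \<phi>)"
proof -
  have "isomorphic G (contract_edges (delete_edges (throttling_graph s a b) (D \<union> X)) F) \<longleftrightarrow>
      (\<exists>\<phi>. contraction_map (delete_edges (throttling_graph s a b) (D \<union> X)) F G \<phi>)" for F D X
    by (rule isomorphic_contract_edges_iff) (use edges_throttling_graph_verts in auto)
  then show ?thesis unfolding obtainable_def by simp
qed

text \<open>The fibres of the cell map are controlled by \<open>front_eqD\<close>, and every edge of
  \<open>G\<close> lifts to an edge between cells by \<open>front_adjacentD\<close>.\<close>

lemma obtainable_if_colored:
  assumes G: "simple_graph G" and S: "S \<subseteq> verts G" and col: "colored G S b = verts G"
  shows "\<exists>a. obtainable (card S) a b G"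
proof -
  define N where "N = closed_nbhd G S - S"
  define s a where "s = card S" and "a = card N"
  have fin: "finite (verts G)" using G by (simp add: simple_graph_def)
  have "N \<subseteq> verts G" using S by (auto simp: N_def closed_nbhd_def)
  then have "finite S" "finite N" using S fin finite_subset by blast+
  then obtain e r where e: "bij_betw e {..<s} S" and r: "bij_betw r {..<a} N"
    unfolding s_def a_def using ex_bij_betw_nat_finite lessThan_atLeast0 by metis
  have eS: "e k \<in> S" if "k < s" for k using e that by (auto simp: bij_betw_def)
  have rN: "r i \<in> closed_nbhd G S" "r i \<notin> S" if "i < a" for i
    using r that by (auto simp: bij_betw_def N_def)
  have r_inj: "i = i'" if "r i = r i'" "i < a" "i' < a" for i i'
    using r that by (auto simp: bij_betw_def inj_on_def)
  define \<phi> :: "gvertex \<Rightarrow> 'a" where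
    "\<phi> x = (case x of Inl k \<Rightarrow> e k | Inr p \<Rightarrow> front G S (r (fst p)) (snd p))" for x
  have \<phi> [simp]: "\<phi> (Inl k) = e k" "\<phi> (Inr (i, j)) = front G S (r i) j" for k i j
    by (simp_all add: \<phi>_def)
  \<comment> \<open>Quantifying over all pairs of ends avoids orienting an edge; for
    \<open>D\<close> and \<open>X\<close> the pairs of equal ends are harmless, as \<open>G\<close>
    has no loops.\<close>
  define F where "F = {p \<in> path_edges s a b. \<forall>x\<in>p. \<forall>y\<in>p. \<phi> x = \<phi> y}"
  define D where "D = {p \<in> complete_edges s a b. \<forall>x\<in>p. \<forall>y\<in>p. \<not> adjacent G (\<phi> x) (\<phi> y)}"
  define X where "X = {p \<in> cross_edges s a b. \<forall>x\<in>p. \<forall>y\<in>p. \<not> adjacent G (\<phi> x) (\<phi> y)}"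
  let ?T = "throttling_graph s a b"
  let ?H = "delete_edges ?T (D \<union> X)"
  have F_iff: "{x, y} \<in> F \<longleftrightarrow> {x, y} \<in> path_edges s a b \<and> \<phi> x = \<phi> y" for x y
    unfolding F_def by auto
  have irrefl: "\<not> adjacent G u u" for u using simple_graph_adjacentD(3)[OF G] by blast
  have D_iff: "{x, y} \<in> D \<longleftrightarrow> {x, y} \<in> complete_edges s a b \<and> \<not> adjacent G (\<phi> x) (\<phi> y)" for x y
    unfolding D_def using irrefl adjacent_sym[of G "\<phi> x" "\<phi> y"] by auto
  have X_iff: "{x, y} \<in> X \<longleftrightarrow> {x, y} \<in> cross_edges s a b \<and> \<not> adjacent G (\<phi> x) (\<phi> y)" for x y
    unfolding X_def using irrefl adjacent_sym[of G "\<phi> x" "\<phi> y"] by auto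
  have H_iff: "{x, y} \<in> edges ?H \<longleftrightarrow> {x, y} \<in> path_edges s a b \<or>
      ({x, y} \<in> complete_edges s a b \<union> cross_edges s a b \<and> adjacent G (\<phi> x) (\<phi> y))" for x y
    using edge_kinds_disjoint[of x y s a b] D_iff[of x y] X_iff[of x y]
    by (auto simp: edges_throttling_graph)
  have frontV: "front G S (r i) j \<in> verts G" "front G S (r i) j \<notin> S" if "i < a" for i j
    using front_colored[OF rN(1)[OF that]] colored_subset_verts[OF S] front_notin[OF rN(2)[OF that]]
    by blast+
  have sep: "e k \<noteq> front G S (r i) j" if "k < s" "i < a" for k i j
    using eS[OF that(1)] frontV(2)[OF that(2)] by metis
  have \<phi>V: "\<phi> x \<in> verts G" if "x \<in> verts ?T" for x
    using that eS S frontV by (auto simp: verts_throttling_graph)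
  have "\<phi> ` verts ?T = verts G"
  proof
    show "verts G \<subseteq> \<phi> ` verts ?T"
    proof
      fix v assume v: "v \<in> verts G"
      show "v \<in> \<phi> ` verts ?T"
      proof (cases "v \<in> S")
        case True
        then obtain k where "k < s" "v = e k" using e by (auto simp: bij_betw_def)
        then show ?thesis by (intro image_eqI[of _ _ "Inl k"]) (auto simp: verts_throttling_graph)
      next
        case False
        \<comment> \<open>A vertex outside \<open>S\<close> is colored at time 1 or later. With
          \<open>b = Suc m\<close> its chain reaches it in some column \<open>j \<le> m\<close>,
          which lies inside the grid.\<close>
        with v col have "b \<noteq> 0" by (metis colored.simps(1))
        then obtain m where b: "b = Suc m" using not0_implies_Suc by blast
        with v col False have "v \<in> colored G S (Suc m) - S" by simp
        then obtain u j where u: "u \<in> N" "j \<le> m" "front G S u j = v"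
          using front_covers unfolding N_def by metis
        then obtain i where "i < a" "u = r i" using r by (auto simp: bij_betw_def)
        with u b show ?thesis
          by (intro image_eqI[of _ _ "Inr (i, j)"]) (auto simp: verts_throttling_graph)
      qed
    qed
  qed (use \<phi>V in blast)
  moreover have "\<phi> x = \<phi> y \<longleftrightarrow> (x, y) \<in> {(x, y). {x, y} \<in> F}\<^sup>*" (is "_ \<longleftrightarrow> _ \<in> ?R\<^sup>*")
    if "x \<in> verts ?T" "y \<in> verts ?T" for x y
  proof
    have "sym (?R\<^sup>*)" by (rule sym_rtrancl) (auto simp: sym_def insert_commute)
    have chain: "(Inr (i, j), Inr (i, j')) \<in> ?R\<^sup>*"
      if "j \<le> j'" "j' < b" "i < a" "front G S (r i) j = front G S (r i) j'" for i j j'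
    proof -
      have stay: "front G S (r i) l = front G S (r i) j" if "j \<le> l" "l \<le> j'" for l
        using front_eqD(2)[OF rN(1) rN(1)] that \<open>i < a\<close> \<open>j \<le> j'\<close> \<open>front G S (r i) j = front G S (r i) j'\<close>
        by blast
      have "l \<le> j' \<longrightarrow> (Inr (i, j), Inr (i, l)) \<in> ?R\<^sup>*" if "j \<le> l" for l
        using that
      proof (induction l rule: dec_induct)
        case (step l)
        show ?case
        proof
          assume l: "Suc l \<le> j'"
          have "{Inr (i, l), Inr (i, Suc l)} \<in> F"
            unfolding F_iff
            using l \<open>i < a\<close> \<open>j' < b\<close> stay[of l] stay[of "Suc l"] step.hyps by (simp add: path_edges_Suc)
          with step l show "(Inr (i, j), Inr (i, Suc l)) \<in> ?R\<^sup>*"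
            by (auto intro: rtrancl_into_rtrancl)
        qed
      qed simp
      then show ?thesis using that by blast
    qed
    assume eq: "\<phi> x = \<phi> y"
    show "(x, y) \<in> ?R\<^sup>*"
    proof (cases x; cases y)
      fix k k' assume xy: "x = Inl k" "y = Inl k'"
      with that eq have "k = k'" using e by (auto simp: verts_throttling_graph bij_betw_def inj_on_def)
      with xy show ?thesis by simp
    next
      fix k p assume "x = Inl k" "y = Inr p"
      with that eq sep sep[symmetric] show ?thesis by (cases p) (auto simp: verts_throttling_graph)
    next
      fix k p assume "x = Inr p" "y = Inl k"
      with that eq sep sep[symmetric] show ?thesis by (cases p) (auto simp: verts_throttling_graph)
    next
      fix p p' assume "x = Inr p" "y = Inr p'"
      then obtain i j i' j' where xy: "x = Inr (i, j)" "y = Inr (i', j')"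
        using surj_pair[of p] surj_pair[of p'] by blast
      with that have lt: "i < a" "j < b" "i' < a" "j' < b" by (auto simp: verts_throttling_graph)
      from eq xy have eq': "front G S (r i) j = front G S (r i') j'" by simp
      then have "r i = r i'"
        using front_eqD(1)[OF rN(1) rN(1)] lt by (metis nat_le_linear)
      then have "i' = i" using r_inj lt by blast
      with eq' chain lt \<open>sym (?R\<^sup>*)\<close> show ?thesis
        unfolding xy by (metis nat_le_linear symD)
    qed
  next
    assume "(x, y) \<in> ?R\<^sup>*"
    then show "\<phi> x = \<phi> y" by (induction rule: rtrancl_induct) (auto simp: F_iff)
  qed
  moreover have "adjacent G u v \<longleftrightarrow> u \<noteq> v \<and> (\<exists>x y. {x, y} \<in> edges ?H \<and> \<phi> x = u \<and> \<phi> y = v)"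
    if uv: "u \<in> verts G" "v \<in> verts G" for u v
  proof
    assume "u \<noteq> v \<and> (\<exists>x y. {x, y} \<in> edges ?H \<and> \<phi> x = u \<and> \<phi> y = v)"
    then obtain x y where xy: "\<phi> x \<noteq> \<phi> y" "{x, y} \<in> edges ?H" "\<phi> x = u" "\<phi> y = v" by blast
    show "adjacent G u v"
    proof (cases "{x, y} \<in> path_edges s a b")
      case True
      with xy(1) show ?thesis
        unfolding path_edges_iff xy(3,4)[symmetric]
        using front_adjacent_Suc[of G S] adjacent_sym[of G] by (metis \<phi>(2))
    next
      case False
      with xy H_iff show ?thesis by blast
    qed
  next
    assume adj: "adjacent G u v"
    have swap: "\<exists>x y. {x, y} \<in> edges ?H \<and> \<phi> x = v \<and> \<phi> y = u"
      if "\<exists>x y. {x, y} \<in> edges ?H \<and> \<phi> x = u \<and> \<phi> y = v" for u v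
    proof -
      from that obtain x y where "{x, y} \<in> edges ?H" "\<phi> x = u" "\<phi> y = v" by blast
      then have "{y, x} \<in> edges ?H \<and> \<phi> y = v \<and> \<phi> x = u" by (simp only: insert_commute)
      then show ?thesis by blast
    qed
    \<comment> \<open>A neighbour of \<open>S\<close> is colored at time 1, so its chain has stood
      there since column 0, where the cross edges are.\<close>
    have cross: "\<exists>x y. {x, y} \<in> edges ?H \<and> \<phi> x = e k \<and> \<phi> y = front G S (r i) j"
      if "adjacent G (e k) (front G S (r i) j)" "k < s" "i < a" "j < b" for k i j
    proof -
      have "front G S (r i) j \<in> colored G S (Suc 0)"
        using that eS frontV by (auto simp: closed_nbhd_def)
      then have "front G S (r i) 0 = front G S (r i) j" by (intro front_stays) auto
      moreover have "{Inl k, Inr (i, 0)} \<in> cross_edges s a b"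
        using that by (auto simp: cross_edges_iff)
      ultimately have "{Inl k, Inr (i, 0)} \<in> edges ?H \<and> \<phi> (Inl k) = e k \<and>
          \<phi> (Inr (i, 0)) = front G S (r i) j"
        using that(1) H_iff by simp
      then show ?thesis by blast
    qed
    \<comment> \<open>Either both vertices are fronts in a common column \<open>l\<close>, which
      gives a complete edge, or one chain steps from the first to the second, which gives a path
      edge.\<close>
    have grid: "\<exists>x y. {x, y} \<in> edges ?H \<and> \<phi> x = front G S (r i) j \<and> \<phi> y = front G S (r i') j'"
      if adj: "adjacent G (front G S (r i) j) (front G S (r i') j')"
        and lt: "i < a" "i' < a" "j \<le> j'" "j' < b" for i i' j j'
      using front_adjacentD[OF G rN(1)[OF lt(1)] rN(1)[OF lt(2)] lt(3) adj]
    proof (elim disjE exE conjE)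
      fix l assume l: "j \<le> l" "l \<le> j'" "front G S (r i) l = front G S (r i) j"
        "front G S (r i') l = front G S (r i') j'"
      have "i \<noteq> i'" using l(3,4) adj irrefl by metis
      then have "{Inr (i, l), Inr (i', l)} \<in> complete_edges s a b"
        using l lt by (auto simp: complete_edges_iff)
      then have "{Inr (i, l), Inr (i', l)} \<in> edges ?H"
        using adj l(3,4) H_iff by simp
      with l(3,4) show ?thesis using \<phi>(2) by metis
    next
      fix l assume l: "r i = r i'" "j \<le> l" "l < j'" "front G S (r i) l = front G S (r i) j"
        "front G S (r i) (Suc l) = front G S (r i) j'"
      then have "{Inr (i, l), Inr (i, Suc l)} \<in> edges ?H"
        unfolding H_iff using lt by (simp add: path_edges_Suc)
      with l show ?thesis using \<phi>(2) by metis
    qed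
    obtain x y where xy: "x \<in> verts ?T" "y \<in> verts ?T" "u = \<phi> x" "v = \<phi> y"
      using uv \<open>\<phi> ` verts ?T = verts G\<close> by blast
    have "\<exists>x y. {x, y} \<in> edges ?H \<and> \<phi> x = u \<and> \<phi> y = v"
    proof (cases x; cases y)
      fix k k' assume k: "x = Inl k" "y = Inl k'"
      with xy adj irrefl have "k \<noteq> k'" "k < s" "k' < s" by (auto simp: verts_throttling_graph)
      then have "{x, y} \<in> complete_edges s a b" by (auto simp: k complete_edges_iff)
      then have "{x, y} \<in> edges ?H" using H_iff adj xy by blast
      with xy show ?thesis by blast
    next
      fix k p assume "x = Inl k" "y = Inr p"
      with xy adj cross show ?thesis by (cases p) (auto simp: verts_throttling_graph)
    next
      fix k p assume k: "x = Inr p" "y = Inl k"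
      have "adjacent G v u" using adj adjacent_sym[of G u v] by simp
      with k xy cross have "\<exists>x y. {x, y} \<in> edges ?H \<and> \<phi> x = v \<and> \<phi> y = u"
        by (cases p) (auto simp: verts_throttling_graph)
      then show ?thesis by (rule swap)
    next
      fix p p' assume "x = Inr p" "y = Inr p'"
      then obtain i j i' j' where ij: "x = Inr (i, j)" "y = Inr (i', j')"
        using surj_pair[of p] surj_pair[of p'] by blast
      with xy have lt: "i < a" "j < b" "i' < a" "j' < b" by (auto simp: verts_throttling_graph)
      have uv: "u = front G S (r i) j" "v = front G S (r i') j'" using xy ij by simp_all
      have "adjacent G v u" using adj adjacent_sym[of G u v] by simp
      then show ?thesis
        using grid[of i j i' j'] swap[OF grid[of i' j' i j]] adj lt uv nat_le_linear[of j j'] by blast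
    qed
    then show "u \<noteq> v \<and> (\<exists>x y. {x, y} \<in> edges ?H \<and> \<phi> x = u \<and> \<phi> y = v)"
      using adj irrefl by blast
  qed
  ultimately have "contraction_map ?H F G \<phi>" unfolding contraction_map_def by simp
  moreover have "saturates (cross_edges s a b - X) (a_vertices s a b)"
    unfolding saturates_def
  proof
    fix v assume "v \<in> a_vertices s a b"
    then obtain i k where v: "v = Inr (i, 0)" "i < a" "0 < b"
      unfolding a_vertices_def cross_edges_def by auto
    \<comment> \<open>Chains start at neighbours of \<open>S\<close>, so some cross edge at every
      start survives the deletion.\<close>
    then obtain w where w: "w \<in> S" "adjacent G w (r i)" using rN[of i] by (auto simp: closed_nbhd_def)
    then obtain k where "k < s" "w = e k" using e by (auto simp: bij_betw_def)
    with v w have "{Inl k, v} \<in> cross_edges s a b - X"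
      unfolding Diff_iff X_iff by (auto simp: cross_edges_iff)
    then show "\<exists>e\<in>cross_edges s a b - X. v \<in> e" by blast
  qed
  moreover have "F \<subseteq> path_edges s a b" "D \<subseteq> complete_edges s a b" "X \<subseteq> cross_edges s a b"
    unfolding F_def D_def X_def by blast+
  ultimately show ?thesis unfolding obtainable_iff s_def by blast
qed

text \<open>A path in \<open>F\<close> stays in its row and changes the column by one at a time, so
  it cannot get beyond column \<open>j\<close> without passing \<open>(i, Suc j)\<close>. Hence, if
  these two cells are not merged, the whole class of \<open>(i, j)\<close> lies in columns up to
  \<open>j\<close>.\<close>

lemma rtrancl_path_edges:
  assumes "F \<subseteq> path_edges s a b" "(Inr (i, j), x) \<in> {(x, y). {x, y} \<in> F}\<^sup>*"
  shows "\<exists>j'. x = Inr (i, j') \<and> (j < j' \<longrightarrow> (Inr (i, j), Inr (i, Suc j)) \<in> {(x, y). {x, y} \<in> F}\<^sup>*)"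
  using assms(2)
proof (induction rule: rtrancl_induct)
  case base
  then show ?case by simp
next
  case (step x y)
  then obtain j' where j': "x = Inr (i, j')"
    "j < j' \<longrightarrow> (Inr (i, j), Inr (i, Suc j)) \<in> {(x, y). {x, y} \<in> F}\<^sup>*" by blast
  have "{x, y} \<in> path_edges s a b" using step.hyps(2) assms(1) by auto
  then have y: "y = Inr (i, Suc j') \<or> (\<exists>l. j' = Suc l \<and> y = Inr (i, l))"
    unfolding path_edges_iff j'(1) by auto
  show ?case
  proof (cases "j' = j \<and> y = Inr (i, Suc j')")
    case True
    with step.hyps(1) step.hyps(2) j' show ?thesis by (auto intro: rtrancl_into_rtrancl)
  next
    case False
    with y j' show ?thesis by (auto simp: less_Suc_eq)
  qed
qed

lemma colored_if_obtainable:
  assumes G: "simple_graph G" and s: "s \<ge> 1" and obt: "obtainable s a b G"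
  shows "\<exists>S\<subseteq>verts G. card S \<le> s \<and> colored G S b = verts G"
proof -
  let ?T = "throttling_graph s a b"
  obtain F D X \<phi> where F: "F \<subseteq> path_edges s a b" and D: "D \<subseteq> complete_edges s a b"
    and X: "X \<subseteq> cross_edges s a b" and sat: "saturates (cross_edges s a b - X) (a_vertices s a b)"
    and map: "contraction_map (delete_edges ?T (D \<union> X)) F G \<phi>"
    using obt unfolding obtainable_iff by blast
  let ?E = "edges (delete_edges ?T (D \<union> X))"
  have im: "\<phi> ` verts ?T = verts G"
    using map unfolding contraction_map_def by simp
  then have \<phi>V: "\<phi> x \<in> verts G" if "x \<in> verts ?T" for x using that by blast
  have eq: "\<phi> x = \<phi> y \<longleftrightarrow> (x, y) \<in> {(x, y). {x, y} \<in> F}\<^sup>*"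
    if "x \<in> verts ?T" "y \<in> verts ?T" for x y
    using map that unfolding contraction_map_def by simp
  have adj: "adjacent G u v \<longleftrightarrow> u \<noteq> v \<and> (\<exists>x y. {x, y} \<in> ?E \<and> \<phi> x = u \<and> \<phi> y = v)"
    if "u \<in> verts G" "v \<in> verts G" for u v
    using map that unfolding contraction_map_def by simp
  define S where "S = \<phi> ` Inl ` {..<s}"
  have InlT: "Inl k \<in> verts ?T" if "k < s" for k using that by (simp add: verts_throttling_graph)
  have InrT: "Inr (i, j) \<in> verts ?T" if "i < a" "j < b" for i j
    using that by (auto simp: verts_throttling_graph)
  have S: "S \<subseteq> verts G" using InlT \<phi>V by (auto simp: S_def)
  have "card S \<le> card ((Inl :: nat \<Rightarrow> gvertex) ` {..<s})" unfolding S_def by (rule card_image_le) simp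
  also have "\<dots> \<le> card {..<s}" by (rule card_image_le) simp
  finally have cardS: "card S \<le> s" by simp
  have S_col: "S \<subseteq> colored G S k" for k using colored_mono[of 0 k G S] by simp
  \<comment> \<open>Strong induction over columns with the row arbitrary: forcing in one row
    requires all rows to be colored up to column \<open>l\<close>.\<close>
  have grid: "\<phi> (Inr (i, j)) \<in> colored G S (Suc j)" if "i < a" "j < b" for i j
    using that
  proof (induction j arbitrary: i rule: less_induct)
    case (less j)
    show ?case
    proof (cases j)
      case 0
      then have b: "0 < b" using less.prems by simp
      then have "Inr (i, 0) \<in> a_vertices s a b" using a_vertices_eq[OF s] less.prems by blast
      then obtain p where p: "p \<in> cross_edges s a b - X" "Inr (i, 0) \<in> p"
        using sat unfolding saturates_def by blast
      then obtain k where k: "p = {Inl k, Inr (i, 0)}" "k < s" unfolding cross_edges_def by auto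
      have "p \<in> ?E"
        using p D edge_kinds_disjoint(2)[of "Inl k" "Inr (i, 0)" s a b] k
        by (auto simp: edges_throttling_graph)
      then have "adjacent G (\<phi> (Inl k)) (\<phi> (Inr (i, 0))) \<or> \<phi> (Inr (i, 0)) = \<phi> (Inl k)"
        using adj[OF \<phi>V[OF InlT[OF k(2)]] \<phi>V[OF InrT[OF less.prems(1) b]]] k(1) by auto
      moreover have "\<phi> (Inl k) \<in> S" using k by (simp add: S_def)
      ultimately show ?thesis
        using \<phi>V[OF InrT[OF less.prems(1) b]] 0 by (auto simp: closed_nbhd_def)
    next
      case (Suc l)
      let ?C = "colored G S (Suc l)" and ?c = "\<phi> (Inr (i, l))" and ?v = "\<phi> (Inr (i, Suc l))"
      have lt: "i < a" "l < b" "Suc l < b" using less.prems Suc by simp_all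
      have below: "\<phi> (Inr (i', j')) \<in> ?C" if "i' < a" "j' \<le> l" for i' j'
        using less.IH[of j' i'] colored_mono[of "Suc j'" "Suc l" G S] that lt Suc by auto
      have "?v \<in> colored G S (Suc (Suc l))"
      \<comment> \<open>If the path edge was contracted, \<open>?v\<close> equals \<open>?c\<close>
        and falls under the first case; otherwise \<open>?c\<close> forces it.\<close>
      proof (cases "?v \<in> ?C")
        case True
        then show ?thesis using colored_Suc_mono[of G S "Suc l"] by blast
      next
        case False
        have c: "?c \<in> ?C" "?c \<noteq> ?v" using below[of i l] lt False by auto
        have V: "?c \<in> verts G" "?v \<in> verts G" using \<phi>V InrT lt by auto
        have path: "{Inr (i, l), Inr (i, Suc l)} \<in> path_edges s a b"
          using lt by (simp add: path_edges_Suc)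
        then have "{Inr (i, l), Inr (i, Suc l)} \<in> ?E"
          using edge_kinds_disjoint(1)[OF path] D X by (auto simp: edges_throttling_graph)
        then have "adjacent G ?c ?v" using adj[OF V] c by blast
        \<comment> \<open>An edge at the merged vertex \<open>?c\<close> comes from some cell
          \<open>x\<close> of its class, whose column is at most \<open>l\<close>. From there,
          complete and cross edges lead to colored vertices, and a path edge reaches column
          \<open>Suc l\<close> at most, in the same row.\<close>
        moreover have "w = ?v" if w: "w \<in> verts G" "adjacent G ?c w" "w \<notin> ?C" for w
        proof -
          obtain x y where xy: "{x, y} \<in> ?E" "\<phi> x = ?c" "\<phi> y = w"
            using adj[OF V(1) w(1)] w(2) by blast
          then have "{x, y} \<in> edges ?T" by simp
          from edges_throttling_graph_verts[OF this] have xyT: "x \<in> verts ?T" "y \<in> verts ?T" by auto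
          have "(Inr (i, l), x) \<in> {(x, y). {x, y} \<in> F}\<^sup>*"
            using eq[OF InrT[OF lt(1,2)] xyT(1)] xy(2) by simp
          from rtrancl_path_edges[OF F this] obtain j' where j': "x = Inr (i, j')"
            "l < j' \<longrightarrow> (Inr (i, l), Inr (i, Suc l)) \<in> {(x, y). {x, y} \<in> F}\<^sup>*" by blast
          have "j' \<le> l" using j'(2) c(2) eq[OF InrT[OF lt(1,2)] InrT[OF lt(1,3)]] by force
          from \<open>{x, y} \<in> edges ?T\<close> consider "{x, y} \<in> path_edges s a b"
            | "{x, y} \<in> complete_edges s a b" | "{x, y} \<in> cross_edges s a b"
            unfolding edges_throttling_graph by blast
          then show ?thesis
          proof cases
            case 1
            then obtain m where m: "y = Inr (i, m)" "m \<le> Suc j'"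
              unfolding path_edges_iff j'(1) by auto
            then have "\<not> m \<le> l" using below[of i m] w(3) xy(3) lt by auto
            with m \<open>j' \<le> l\<close> have "m = Suc l" by simp
            with m xy(3) show ?thesis by simp
          next
            case 2
            then obtain i' where "y = Inr (i', j')" "i' < a"
              unfolding complete_edges_iff j'(1) by auto
            with \<open>j' \<le> l\<close> below[of i' j'] w(3) xy(3) show ?thesis by simp
          next
            case 3
            then obtain k where "y = Inl k" "k < s"
              unfolding cross_edges_iff j'(1) by auto
            then have "w \<in> S" using xy(3) by (auto simp: S_def)
            with S_col w(3) show ?thesis by blast
          qed
        qed
        ultimately have "{w \<in> verts G. adjacent G ?c w \<and> w \<notin> ?C} = {?v}" using V(2) False by blast
        with c(1) V(2) have "?v \<in> force_step G ?C" unfolding force_step_def by blast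
        then show ?thesis by (simp add: colored.simps)
      qed
      then show ?thesis using Suc by simp
    qed
  qed
  have "verts G \<subseteq> colored G S b"
  proof
    fix v assume "v \<in> verts G"
    then obtain x where x: "x \<in> verts ?T" "v = \<phi> x" using im by blast
    show "v \<in> colored G S b"
    proof (cases x)
      case (Inl k)
      then have "v \<in> S" using x by (auto simp: S_def verts_throttling_graph)
      then show ?thesis using S_col by blast
    next
      case (Inr p)
      then obtain i j where ij: "x = Inr (i, j)" "i < a" "j < b" using x
        by (auto simp: verts_throttling_graph)
      then show ?thesis
        using grid[of i j] colored_mono[of "Suc j" b G S] x by auto
    qed
  qed
  then have "colored G S b = verts G" using colored_subset_verts[OF S] by blast
  with S cardS show ?thesis by blast
qed

text \<open>The budget \<open>t\<close> is split into \<open>card S\<close> and the time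
  \<open>b\<close>. The empty set colors nothing, whence \<open>s \<ge> 1\<close>; conversely, a set
  smaller than \<open>s\<close> leaves at least \<open>b\<close> steps.\<close>

lemma power_throttling_le_iff_obtainable:
  assumes "simple_graph G"
  shows "power_throttling G \<le> t \<longleftrightarrow> (\<exists>a b s. s \<ge> 1 \<and> s + b = t \<and> obtainable s a b G)"
  unfolding power_throttling_le_iff[OF assms]
proof (intro iffI; elim exE conjE)
  fix S assume S: "S \<subseteq> verts G" "card S \<le> t" "colored G S (t - card S) = verts G"
  have "S \<noteq> {}"
    using S(3) assms by (auto simp: colored_empty simple_graph_def)
  moreover have "finite S" using S(1) assms finite_subset by (auto simp: simple_graph_def)
  ultimately have "card S \<ge> 1" by (simp add: Suc_le_eq card_gt_0_iff)
  moreover obtain a where "obtainable (card S) a (t - card S) G"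
    using obtainable_if_colored[OF assms S(1,3)] by blast
  ultimately show "\<exists>a b s. s \<ge> 1 \<and> s + b = t \<and> obtainable s a b G"
    using S(2) by (intro exI[of _ a] exI[of _ "t - card S"] exI[of _ "card S"]) simp
next
  fix a b s assume s: "s \<ge> 1" "s + b = t" "obtainable s a b G"
  then obtain S where S: "S \<subseteq> verts G" "card S \<le> s" "colored G S b = verts G"
    using colored_if_obtainable[OF assms s(1,3)] by blast
  have "colored G S (t - card S) = verts G"
    using colored_mono[of b "t - card S" G S] colored_subset_verts[OF S(1), of "t - card S"] S s(2)
    by auto
  with S s(2) show "\<exists>S\<subseteq>verts G. card S \<le> t \<and> colored G S (t - card S) = verts G"
    by (intro exI[of _ S]) simp
qed

theorem theorem13:
  fixes G :: "'a graph" and t :: nat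
  assumes "simple_graph G" and "t > 0"
  shows "(power_throttling G \<le> t \<longleftrightarrow>
           (\<exists>a b s. s \<ge> 1 \<and> s + b = t \<and> obtainable s a b G)) \<and>
         polytime_decidable (\<lambda>H :: nat graph. \<exists>a b s. s \<ge> 1 \<and> s + b = t \<and> obtainable s a b H)"
proof
  show "power_throttling G \<le> t \<longleftrightarrow> (\<exists>a b s. s \<ge> 1 \<and> s + b = t \<and> obtainable s a b G)"
    by (rule power_throttling_le_iff_obtainable[OF assms(1)])
  show "polytime_decidable (\<lambda>H :: nat graph. \<exists>a b s. s \<ge> 1 \<and> s + b = t \<and> obtainable s a b H)"
    using polytime_decidable_power_throttling_le
    by (rule polytime_decidable_cong[THEN iffD1, rotated]) (rule power_throttling_le_iff_obtainable)
qed

end
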